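(* Suppose that: (I) $Y$ is forward invariant with respect to the solutions of $y'(t)=f(y(t),u(t))$, that is, $\mathcal{U}(y_0)=\mathcal{U}$ for all $y_0\in Y$; (II) there is an open neighbourhood $\mathcal{N}$ of $Y$ such that for every $y_0\in\mathcal{N}$ the limit $\lim_{T\rightarrow\infty}v_T(y_0)=:v^*(y_0)$ exists, the convergence being uniform with respect to $y_0\in\mathcal{N}$, and the limit function $v^*(\cdot)$ is Lipschitz continuous on $\mathcal{N}$. Then, for every $y_0\in Y$ such that $\Omega(y_0)\neq\emptyset$, $$v^*(y_0)\leq k^*(y_0).$$
   Context: Setting. $U$ is a compact metric space, $f:\mathbb{R}^m\times U\to\mathbb{R}^m$ is continuous in $(y,u)$ and Lipschitz in $y$ uniformly in $u\in U$, $k:\mathbb{R}^m\times U\to\mathbb{R}$ is continuous, and $Y\subset\mathbb{R}^m$ is a compact set which is the closure of its interior. The control system is $y'(t)=f(y(t),u(t))$, $u(t)\in U$, $t\in[0,\infty)$. Controls are measurable functions $u(\cdot):[0,\infty)\to U$; $\mathcal{U}$ is the set of all controls, and $y(t,y_0,u)$ is the solution with control $u(\cdot)$ and $y(0)=y_0$. $\mathcal{U}(y_0)$ is the set of controls such that $y(t,y_0,u)\in Y$ for all $t\in[0,\infty)$. For $T>0$ and $y_0\in\mathcal{N}$, $$v_T(y_0)=\frac1T\inf_{u(\cdot)\in\mathcal{U}}\int_0^Tk(y(t,y_0,u),u(t))\,dt$$ (for $y_0\in Y$, under (I), every control keeps the trajectory in $Y$, so this coincides with the infimum over controls satisfying the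 state constraint $y(t,y_0,u)\in Y$ for $t\in[0,T]$). $\mathcal{P}(Y\times U)$ and $\mathcal{M}_+(Y\times U)$ are the Borel probability measures and the finite non-negative Borel measures on $Y\times U$; $C^1$ is the space of continuously differentiable functions $\phi:\mathbb{R}^m\to\mathbb{R}$. Define $$W=\Big\{\gamma\in\mathcal{P}(Y\times U):\int_{Y\times U}\nabla\phi(y)^Tf(y,u)\,\gamma(dy,du)=0\ \ \forall\phi\in C^1\Big\},$$ let $\Omega(y_0)$ be the set of pairs $(\gamma,\xi)\in\mathcal{P}(Y\times U)\times\mathcal{M}_+(Y\times U)$ such that $\gamma\in W$ and $$\int_{Y\times U}(\phi(y_0)-\phi(y))\,\gamma(dy,du)+\int_{Y\times U}\nabla\phi(y)^Tf(y,u)\,\xi(dy,du)=0\quad\forall\phi\in C^1,$$ and let $$k^*(y_0)=\inf_{(\gamma,\xi)\in\Omega(y_0)}\int_{Y\times U}k(y,u)\,\gamma(dy,du).$$ *)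

theory Defs
  imports "HOL-Probability.Probability"
begin

definition controls :: "'u::metric_space set \<Rightarrow> (real \<Rightarrow> 'u) set" where
  "controls U = {u \<in> measurable (lebesgue_on {0..}) borel. \<forall>t\<ge>0. u t \<in> U}"

(* Caratheodory solutions on [0,\<infinity>): locally absolutely continuous functions satisfying the ODE
   almost everywhere, written as an integral equation.  Values at negative times are irrelevant. *)
definition is_solution ::
  "((real^'m) \<times> 'u \<Rightarrow> real^'m) \<Rightarrow> real^'m \<Rightarrow> (real \<Rightarrow> 'u) \<Rightarrow> (real \<Rightarrow> real^'m) \<Rightarrow> bool" where
  "is_solution f y0 u y \<longleftrightarrow>
     (\<forall>t\<ge>0. set_integrable lebesgue {0..t} (\<lambda>s. f (y s, u s)) \<and>
            y t = y0 + (LINT s:{0..t}|lebesgue. f (y s, u s)))"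

(* For f continuous, Lipschitz in y uniformly in u, and U compact, a solution exists for every
   control and its restriction to [0,\<infinity>) is unique, so the choice is immaterial there. *)
definition sol ::
  "((real^'m) \<times> 'u \<Rightarrow> real^'m) \<Rightarrow> real^'m \<Rightarrow> (real \<Rightarrow> 'u) \<Rightarrow> real \<Rightarrow> real^'m" where
  "sol f y0 u = (SOME y. is_solution f y0 u y)"

definition admissible_controls ::
  "((real^'m) \<times> 'u::metric_space \<Rightarrow> real^'m) \<Rightarrow> 'u set \<Rightarrow> (real^'m) set \<Rightarrow> real^'m
     \<Rightarrow> (real \<Rightarrow> 'u) set" where
  "admissible_controls f U Y y0 = {u \<in> controls U. \<forall>t\<ge>0. sol f y0 u t \<in> Y}"

definition v_T ::
  "((real^'m) \<times> 'u::metric_space \<Rightarrow> real^'m) \<Rightarrow> ((real^'m) \<times> 'u \<Rightarrow> real) \<Rightarrow> 'u set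
     \<Rightarrow> real \<Rightarrow> real^'m \<Rightarrow> real" where
  "v_T f k U T y0 =
     (1 / T) * (INF u\<in>controls U. LINT t:{0..T}|lebesgue. k (sol f y0 u t, u t))"

definition C1 :: "(real^'m \<Rightarrow> real) \<Rightarrow> bool" where
  "C1 \<phi> \<longleftrightarrow> (\<exists>g. (\<forall>x. GDERIV \<phi> x :> g x) \<and> continuous_on UNIV g)"

definition grad :: "(real^'m \<Rightarrow> real) \<Rightarrow> real^'m \<Rightarrow> real^'m" where
  "grad \<phi> x = (THE d. GDERIV \<phi> x :> d)"

definition borel_probability_measures :: "'a::topological_space set \<Rightarrow> 'a measure set" where
  "borel_probability_measures X =
     {\<gamma>. sets \<gamma> = sets (restrict_space borel X) \<and> prob_space \<gamma>}"

definition finite_borel_measures :: "'a::topological_space set \<Rightarrow> 'a measure set" where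
  "finite_borel_measures X =
     {\<xi>. sets \<xi> = sets (restrict_space borel X) \<and> finite_measure \<xi>}"

definition W_set ::
  "((real^'m) \<times> 'u::metric_space \<Rightarrow> real^'m) \<Rightarrow> 'u set \<Rightarrow> (real^'m) set
     \<Rightarrow> ((real^'m) \<times> 'u) measure set" where
  "W_set f U Y =
     {\<gamma> \<in> borel_probability_measures (Y \<times> U).
        \<forall>\<phi>. C1 \<phi> \<longrightarrow> (LINT (y, u)|\<gamma>. grad \<phi> y \<bullet> f (y, u)) = 0}"

definition Omega ::
  "((real^'m) \<times> 'u::metric_space \<Rightarrow> real^'m) \<Rightarrow> 'u set \<Rightarrow> (real^'m) set \<Rightarrow> real^'m
     \<Rightarrow> (((real^'m) \<times> 'u) measure \<times> ((real^'m) \<times> 'u) measure) set" where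
  "Omega f U Y y0 =
     {(\<gamma>, \<xi>). \<gamma> \<in> borel_probability_measures (Y \<times> U) \<and> \<xi> \<in> finite_borel_measures (Y \<times> U) \<and>
        \<gamma> \<in> W_set f U Y \<and>
        (\<forall>\<phi>. C1 \<phi> \<longrightarrow>
           (LINT (y, u)|\<gamma>. \<phi> y0 - \<phi> y) + (LINT (y, u)|\<xi>. grad \<phi> y \<bullet> f (y, u)) = 0)}"

definition k_star ::
  "((real^'m) \<times> 'u::metric_space \<Rightarrow> real^'m) \<Rightarrow> ((real^'m) \<times> 'u \<Rightarrow> real) \<Rightarrow> 'u set
     \<Rightarrow> (real^'m) set \<Rightarrow> real^'m \<Rightarrow> real" where
  "k_star f k U Y y0 = (INF (\<gamma>, \<xi>)\<in>Omega f U Y y0. LINT z|\<gamma>. k z)"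

end

theory Submission
  imports Defs
begin

text \<open>
  Two inequalities give the result: for a pair \<open>(\<gamma>, \<xi>)\<close> in \<open>\<Omega>(y\<^sub>0)\<close>,
  \<open>v\<^sup>*(y\<^sub>0) \<le> \<integral> v\<^sup>* d\<gamma> \<le> \<integral> k d\<gamma>\<close>.

  The first one comes from dynamic programming. Running a constant control for a time \<open>s\<close>
  costs an amount that does not depend on the horizon, so in the limit of the averages
  \<open>v\<^sup>*\<close> cannot decrease along a trajectory (\<open>value_limit_nondecreasing\<close>).
  If \<open>v\<^sup>*\<close> were smooth this would read \<open>\<nabla>v\<^sup>* \<bullet> f \<ge> 0\<close>, and the identity that links
  \<open>\<gamma>\<close> and \<open>\<xi>\<close>, applied to \<open>v\<^sup>*\<close>, would give
  \<open>\<integral> (v\<^sup>*(y\<^sub>0) - v\<^sup>*(y)) d\<gamma> = - \<integral> \<nabla>v\<^sup>* \<bullet> f d\<xi> \<le> 0\<close>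
  (\<open>value_le_average_value\<close>).

  The second one comes from the stationarity of \<open>\<gamma>\<close>. Fix a horizon \<open>T\<close> at which \<open>v\<^sub>T\<close> is
  uniformly close to \<open>v\<^sup>*\<close>, and let \<open>G(p)\<close> be the infimum over controls of
  \<open>\<integral>\<^sub>0\<^sup>T (T - t) k dt\<close>. Delaying a control by \<open>s\<close> lowers all weights by \<open>s\<close>, that is, it
  removes \<open>s\<close> times the unweighted cost over \<open>[0, T]\<close>, which is at least \<open>s T v\<^sub>T\<close>; what is
  paid meanwhile is \<open>s T k\<close> up to second order. So, formally,
  \<open>\<nabla>G \<bullet> f \<ge> T (v\<^sup>* - k)\<close> up to a small error (\<open>accumulated_value\<close>). The decreasing weight
  makes \<open>G\<close> a function of the state alone, so that no time derivative appears. Integrating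
  against \<open>\<gamma>\<close> makes the left-hand side vanish (\<open>average_value_le_average_cost\<close>).

  Neither \<open>v\<^sup>*\<close> nor \<open>G\<close> need be smooth, but both are Lipschitz continuous, the second after
  \<open>k\<close> has been replaced by a nearby cost that is Lipschitz in the state
  (\<open>lipschitz_approximation\<close>). Lower bounds for the increments of a Lipschitz function along
  short trajectories with constant control survive convolution with a bump, up to an arbitrarily
  small error, and become pointwise bounds for \<open>\<nabla>\<phi> \<bullet> f\<close> (\<open>mollification\<close>,
  \<open>test_function\<close>). This is where a neighbourhood of \<open>Y\<close> is needed: the convolution at a point
  of \<open>Y\<close> sees trajectories that start nearby, possibly outside \<open>Y\<close>.

  All of this rests on elementary facts about Caratheodory solutions for measurable controls:
  existence, uniqueness, Lipschitz dependence on the initial point, and the behaviour of solutions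
  under concatenation of controls.
\<close>

section \<open>Integrals along trajectories\<close>

text \<open>
  The space of controls need not be second countable, so that measurability of the pair
  \<open>(y t, u t)\<close> is not at hand. But \<open>g (c, u t)\<close> is measurable in \<open>t\<close> for each fixed \<open>c\<close>, and
  \<open>y\<close> is a pointwise limit of functions with countably many values.
\<close>

lemma cost_measurable:
  fixes g :: "'a::metric_space \<times> 'u::metric_space \<Rightarrow> 'b::euclidean_space" and y :: "real \<Rightarrow> 'a"
  assumes g: "continuous_on (UNIV \<times> U) g" and u: "u \<in> controls U" and y: "continuous_on {0..} y"
  shows "(\<lambda>t. g (y t, u t)) \<in> borel_measurable (lebesgue_on {0..})"
proof -
  have uU: "u \<in> measurable (lebesgue_on {0..}) (restrict_space borel U)"
    using u by (auto simp: controls_def intro!: measurable_restrict_space2)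
  \<comment> \<open>the grid point of mesh \<open>1 / (n + 1)\<close> just below \<open>s\<close>\<close>
  define \<tau> where "\<tau> n s = real_of_int \<lfloor>real (Suc n) * s\<rfloor> / real (Suc n)" for n s
  have slice: "(\<lambda>t. g (c, u t)) \<in> borel_measurable (lebesgue_on {0..})" for c
  proof (rule measurable_compose[OF uU])
    have "continuous_on U (\<lambda>a. g (c, a))"
      by (rule continuous_on_compose2[OF g]) (auto intro!: continuous_intros)
    then show "(\<lambda>a. g (c, a)) \<in> borel_measurable (restrict_space borel U)"
      by (rule borel_measurable_continuous_on_restrict)
  qed
  show ?thesis
  proof (rule borel_measurable_LIMSEQ_metric)
    fix n
    have "(\<lambda>s. \<lfloor>real (Suc n) * s\<rfloor>) \<in> measurable borel (count_space UNIV)"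
      by measurable
    then have "(\<lambda>s. \<lfloor>real (Suc n) * s\<rfloor>) \<in> measurable (lebesgue_on {0..}) (count_space UNIV)"
      by (intro measurable_restrict_space1 measurable_completion) simp
    from measurable_compose_countable[OF slice this, of "\<lambda>j. y (real_of_int j / real (Suc n))"]
    show "(\<lambda>s. g (y (\<tau> n s), u s)) \<in> borel_measurable (lebesgue_on {0..})"
      by (simp add: \<tau>_def)
  next
    fix s :: real assume "s \<in> space (lebesgue_on {0..})"
    then have s: "s \<ge> 0" by simp
    have uin: "u s \<in> U" using u s by (auto simp: controls_def)
    have floor_bounds: "s - 1 / N \<le> F / N" if "N * s - 1 \<le> F" "N > 0" for N F :: real
      using divide_right_mono[OF that(1), of N] that(2) by (simp add: diff_divide_distrib)
    have floor_bounds': "F / N \<le> s" if "F \<le> N * s" "N > 0" for N F :: real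
      using that by (simp add: field_simps)
    have bnd: "s - 1 / real (Suc n) \<le> \<tau> n s" "\<tau> n s \<le> s" for n
    proof -
      have fl: "real (Suc n) * s - 1 \<le> real_of_int \<lfloor>real (Suc n) * s\<rfloor>"
        "real_of_int \<lfloor>real (Suc n) * s\<rfloor> \<le> real (Suc n) * s"
        by linarith+
      show "s - 1 / real (Suc n) \<le> \<tau> n s"
        unfolding \<tau>_def by (rule floor_bounds[OF fl(1)]) simp
      show "\<tau> n s \<le> s"
        unfolding \<tau>_def by (rule floor_bounds'[OF fl(2)]) simp
    qed
    have pos: "\<tau> n s \<ge> 0" for n
      using s by (simp add: \<tau>_def)
    have "(\<lambda>n. 1 / real (Suc n)) \<longlonglongrightarrow> 0"
      using LIMSEQ_inverse_real_of_nat by (simp add: inverse_eq_divide)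
    then have "(\<lambda>n. s - 1 / real (Suc n)) \<longlonglongrightarrow> s - 0"
      by (intro tendsto_intros)
    then have low: "(\<lambda>n. s - 1 / real (Suc n)) \<longlonglongrightarrow> s" by (simp only: diff_zero)
    have lim: "(\<lambda>n. \<tau> n s) \<longlonglongrightarrow> s"
    proof (rule tendsto_sandwich[OF _ _ low tendsto_const])
      show "\<forall>\<^sub>F n in sequentially. s - 1 / real (Suc n) \<le> \<tau> n s"
        by (rule always_eventually) (rule allI, rule bnd)
      show "\<forall>\<^sub>F n in sequentially. \<tau> n s \<le> s"
        by (rule always_eventually) (rule allI, rule bnd)
    qed
    have "(\<lambda>n. y (\<tau> n s)) \<longlonglongrightarrow> y s"
      by (rule continuous_on_tendsto_compose[OF y lim]) (use s pos in auto)
    then show "(\<lambda>n. g (y (\<tau> n s), u s)) \<longlonglongrightarrow> g (y s, u s)"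
      by (rule continuous_on_tendsto_compose[OF g tendsto_Pair[OF _ tendsto_const]]) (use uin in auto)
  qed
qed

lemma cost_absolutely_integrable:
  fixes g :: "'a::metric_space \<times> 'u::metric_space \<Rightarrow> 'b::euclidean_space" and y :: "real \<Rightarrow> 'a"
  assumes g: "continuous_on (UNIV \<times> U) g" and u: "u \<in> controls U" and y: "continuous_on {0..} y"
    and U: "compact U" and q: "continuous_on {0..T} q"
  shows "(\<lambda>t. q t *\<^sub>R g (y t, u t)) absolutely_integrable_on {0..T}"
proof -
  have c: "compact ((\<lambda>t. norm (q t)) ` {0..T})" "compact ((\<lambda>z. norm (g z)) ` (y ` {0..T} \<times> U))"
    using q U y
    by (auto intro!: compact_continuous_image compact_Times continuous_intros
         continuous_on_subset[OF g] intro: continuous_on_subset)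
  have "\<exists>A. \<forall>t\<in>{0..T}. norm (q t) \<le> A"
    using compact_imp_bounded[OF c(1)] unfolding bounded_iff by auto
  then obtain A where A: "\<And>t. t \<in> {0..T} \<Longrightarrow> norm (q t) \<le> A" by blast
  have "\<exists>B. \<forall>t\<in>{0..T}. \<forall>a\<in>U. norm (g (y t, a)) \<le> B"
    using compact_imp_bounded[OF c(2)] unfolding bounded_iff by auto
  then obtain B where B: "\<And>t a. t \<in> {0..T} \<Longrightarrow> a \<in> U \<Longrightarrow> norm (g (y t, a)) \<le> B" by blast
  have m1: "(\<lambda>t. g (y t, u t)) \<in> borel_measurable (lebesgue_on {0..T})"
    by (rule measurable_restrict_mono[OF cost_measurable[OF g u y]]) auto
  have m2: "q \<in> borel_measurable (lebesgue_on {0..T})"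
    using q by (rule continuous_imp_measurable_on_sets_lebesgue) auto
  show ?thesis
  proof (rule measurable_bounded_by_integrable_imp_absolutely_integrable)
    show "(\<lambda>t. q t *\<^sub>R g (y t, u t)) \<in> borel_measurable (lebesgue_on {0..T})"
      using m1 m2 by (rule borel_measurable_scaleR[rotated])
    show "(\<lambda>t. A * B) integrable_on {0..T}" by (rule integrable_const_ivl)
    show "norm (q t *\<^sub>R g (y t, u t)) \<le> A * B" if "t \<in> {0..T}" for t
    proof -
      have "norm (q t) * norm (g (y t, u t)) \<le> A * B"
        using u that order_trans[OF norm_ge_zero A[OF that]]
        by (intro mult_mono A[OF that] B[OF that]) (auto simp: controls_def)
      then show ?thesis by simp
    qed
  qed auto
qed

lemma continuous_on_half_line:
  fixes y :: "real \<Rightarrow> 'a::topological_space"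
  assumes "\<And>T. continuous_on {0..T} y"
  shows "continuous_on {0..} y"
  unfolding continuous_on_eq_continuous_within
proof
  fix t :: real assume t: "t \<in> {0..}"
  have "continuous (at t within {0..t + 1}) y"
    using assms[of "t + 1"] t by (auto simp: continuous_on_eq_continuous_within)
  moreover have "at t within {0..} = at t within {0..t + 1}"
    by (rule at_within_nhd[of _ "{..<t + 1}"]) auto
  ultimately show "continuous (at t within {0..}) y" by simp
qed

lemma has_integral_exp_scaled:
  assumes "c \<noteq> (0::real)" "t \<ge> 0"
  shows "((\<lambda>s. exp (c * s)) has_integral (exp (c * t) - 1) / c) {0..t}"
proof -
  have "((\<lambda>s. exp (c * s)) has_integral (exp (c * t) / c - exp (c * 0) / c)) {0..t}"
    by (rule fundamental_theorem_of_calculus[OF assms(2)])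
      (use assms in \<open>auto intro!: derivative_eq_intros simp: has_real_derivative_iff_has_vector_derivative[symmetric]\<close>)
  then show ?thesis by (simp add: diff_divide_distrib)
qed

text \<open>
  The largest value \<open>S\<close> of \<open>exp (- (2 L + 1) t) h t\<close> satisfies \<open>S \<le> a + S / 2\<close>, because the
  weight makes the integral operator a contraction. Hence the factor 2 in the bound, in
  place of a sharp bound.
\<close>

lemma gronwall_weighted:
  fixes h :: "real \<Rightarrow> real"
  assumes h: "continuous_on {0..T} h" and L: "L \<ge> 0" and a: "a \<ge> 0"
    and le: "\<And>t. t \<in> {0..T} \<Longrightarrow> h t \<le> a + L * integral {0..t} h" and t: "t \<in> {0..T}"
  shows "h t \<le> 2 * a * exp ((2 * L + 1) * t)"
proof -
  define c where "c = 2 * L + 1"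
  have c: "c > 0" "L / c \<le> 1 / 2" using L by (auto simp: c_def field_simps)
  have "continuous_on {0..T} (\<lambda>t. exp (- c * t) * h t)" by (intro continuous_intros h)
  then obtain r where r: "r \<in> {0..T}" "\<And>s. s \<in> {0..T} \<Longrightarrow> exp (- c * s) * h s \<le> exp (- c * r) * h r"
    using continuous_attains_sup[of "{0..T}" "\<lambda>t. exp (- c * t) * h t"] t by auto
  define S where "S = exp (- c * r) * h r"
  have hS: "h s \<le> S * exp (c * s)" if "s \<in> {0..T}" for s
    using r(2)[OF that] by (simp add: S_def exp_minus field_simps)
  have S2: "S \<le> 2 * a"
  proof (cases "S \<le> 0")
    case True
    then show ?thesis using a by linarith
  next
    case False
    have "integral {0..r} h \<le> integral {0..r} (\<lambda>s. S * exp (c * s))"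
    proof (rule integral_le)
      show "h integrable_on {0..r}"
        by (rule integrable_continuous_interval) (use r in \<open>auto intro: continuous_on_subset[OF h]\<close>)
      show "(\<lambda>s. S * exp (c * s)) integrable_on {0..r}"
        by (intro integrable_continuous_interval continuous_intros)
    qed (use hS r in auto)
    also have "\<dots> = S * ((exp (c * r) - 1) / c)"
      using has_integral_exp_scaled[of c r] c r by (simp add: integral_unique)
    also have "\<dots> \<le> S * exp (c * r) / c"
      using False c by (simp add: field_simps)
    finally have "L * integral {0..r} h \<le> L * (S * exp (c * r) / c)"
      using L by (rule mult_left_mono)
    also have "\<dots> = (L / c) * (S * exp (c * r))" by simp
    also have "\<dots> \<le> (1 / 2) * (S * exp (c * r))"
      using c False by (intro mult_right_mono) auto
    finally have "h r \<le> a + S * exp (c * r) / 2" using le[OF r(1)] by simp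
    then have "exp (- c * r) * h r \<le> exp (- c * r) * (a + S * exp (c * r) / 2)"
      by (intro mult_left_mono) auto
    also have "\<dots> = exp (- c * r) * a + S / 2"
      by (simp add: algebra_simps exp_minus)
    also have "exp (- c * r) * a \<le> 1 * a"
      using a c r by (intro mult_right_mono) auto
    finally have "S \<le> a + S / 2" unfolding S_def by simp
    then show ?thesis by simp
  qed
  have "h t \<le> S * exp (c * t)" by (rule hS[OF t])
  also have "\<dots> \<le> 2 * a * exp (c * t)" using S2 by (intro mult_right_mono) auto
  finally show ?thesis by (simp add: c_def)
qed

lemma integral_concat:
  fixes h :: "real \<Rightarrow> 'a::euclidean_space"
  assumes s: "0 \<le> s" "s \<le> T" and h: "h integrable_on {0..T}"
    and h1: "\<And>t. t \<in> {0..s} \<Longrightarrow> h t = h1 t"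
    and h2: "\<And>t. s < t \<Longrightarrow> t \<le> T \<Longrightarrow> h t = h2 (t - s)"
  shows "integral {0..T} h = integral {0..s} h1 + integral {0..T - s} h2"
proof -
  have "integral {0..T} h = integral {0..s} h + integral {s..T} h"
    using Henstock_Kurzweil_Integration.integral_combine[OF s h] by simp
  also have "integral {0..s} h = integral {0..s} h1"
    by (intro Henstock_Kurzweil_Integration.integral_cong h1)
  also have "integral {s..T} h = integral {s..T} (\<lambda>t. h2 (t + - s))"
    by (rule integral_spike[of "{s}"]) (use h2 in auto)
  also have "\<dots> = integral {0..T - s} h2"
    using integral_shift_real_ivl[of 0 "- s" "T - s" h2] by simp
  finally show ?thesis .
qed

section \<open>Trajectories of the control system\<close>

locale control_system =
  fixes U :: "'u::metric_space set" and f :: "(real^'m) \<times> 'u \<Rightarrow> real^'m" and L :: real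
  assumes compact_U: "compact U" and U_nonempty: "U \<noteq> {}"
    and cont_f: "continuous_on (UNIV \<times> U) f"
    and lip_f: "\<And>a. a \<in> U \<Longrightarrow> L-lipschitz_on UNIV (\<lambda>y. f (y, a))"
begin

lemma L_nonneg: "L \<ge> 0"
  using U_nonempty lip_f lipschitz_on_nonneg by fastforce

lemma lip_fD: "a \<in> U \<Longrightarrow> norm (f (y, a) - f (z, a)) \<le> L * norm (y - z)"
  using lip_f lipschitz_on_normD by blast

lemma controlsD: "u \<in> controls U \<Longrightarrow> t \<ge> 0 \<Longrightarrow> u t \<in> U"
  by (simp add: controls_def)

lemma const_control: "a \<in> U \<Longrightarrow> (\<lambda>_. a) \<in> controls U"
  by (simp add: controls_def)

lemma controls_nonempty: "controls U \<noteq> {}"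
  using U_nonempty const_control by blast

lemma bounded_on_compact:
  fixes g :: "(real^'m) \<times> 'u \<Rightarrow> 'b::real_normed_vector"
  assumes "continuous_on (UNIV \<times> U) g" "compact K"
  obtains B where "B \<ge> 0" "\<And>y a. y \<in> K \<Longrightarrow> a \<in> U \<Longrightarrow> norm (g (y, a)) \<le> B"
proof -
  have "compact (g ` (K \<times> U))"
    using assms compact_U by (intro compact_continuous_image compact_Times continuous_on_subset[OF assms(1)]) auto
  then have "bounded (g ` (K \<times> U))" by (rule compact_imp_bounded)
  then have "\<exists>B. \<forall>y\<in>K. \<forall>a\<in>U. norm (g (y, a)) \<le> B" unfolding bounded_iff by blast
  then obtain B where B: "\<And>y a. y \<in> K \<Longrightarrow> a \<in> U \<Longrightarrow> norm (g (y, a)) \<le> B" by blast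
  show ?thesis
  proof (rule that[of "max B 0"])
    show "norm (g (y, a)) \<le> max B 0" if "y \<in> K" "a \<in> U" for y a
      using B[OF that] by simp
  qed simp
qed

lemma is_solution_continuous:
  assumes "is_solution f p u y"
  shows "continuous_on {0..} y"
proof -
  have "continuous_on {0..T} y" for T
  proof (cases "T \<ge> 0")
    case True
    have i: "(\<lambda>s. f (y s, u s)) absolutely_integrable_on {0..t}"
      and e: "y t = p + (LINT s:{0..t}|lebesgue. f (y s, u s))" if "t \<ge> 0" for t
      using assms that unfolding is_solution_def by blast+
    have "(\<lambda>s. f (y s, u s)) integrable_on {0..T}"
      by (rule set_lebesgue_integral_eq_integral(1)[OF i[OF True]])
    then have "continuous_on {0..T} (\<lambda>t. p + integral {0..t} (\<lambda>s. f (y s, u s)))"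
      by (rule continuous_on_add[OF continuous_on_const indefinite_integral_continuous_1])
    then show ?thesis
    proof (rule continuous_on_eq)
      fix t assume "t \<in> {0..T}"
      then have "t \<ge> 0" by simp
      then show "p + integral {0..t} (\<lambda>s. f (y s, u s)) = y t"
        using e[of t] set_lebesgue_integral_eq_integral(2)[OF i[of t]] by simp
    qed
  qed auto
  then show ?thesis
    by (rule continuous_on_half_line)
qed

lemma velocity_integrable:
  assumes "u \<in> controls U" "continuous_on {0..} y"
  shows "(\<lambda>s. f (y s, u s)) absolutely_integrable_on {0..t}"
  using cost_absolutely_integrable[OF cont_f assms compact_U continuous_on_const[of _ 1]]
  unfolding scaleR_one .

lemma velocity_integrable_on:
  "u \<in> controls U \<Longrightarrow> continuous_on {0..} y \<Longrightarrow> (\<lambda>s. f (y s, u s)) integrable_on {0..t}"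
  by (rule set_lebesgue_integral_eq_integral(1)[OF velocity_integrable])

lemma is_solution_iff:
  assumes u: "u \<in> controls U"
  shows "is_solution f p u y \<longleftrightarrow>
    continuous_on {0..} y \<and> (\<forall>t\<ge>0. y t = p + integral {0..t} (\<lambda>s. f (y s, u s)))"
proof -
  have eq: "(LINT s:{0..t}|lebesgue. f (y s, u s)) = integral {0..t} (\<lambda>s. f (y s, u s))"
    if "continuous_on {0..} y" for t
    by (rule set_lebesgue_integral_eq_integral(2)[OF velocity_integrable[OF u that]])
  show ?thesis
  proof
    assume "is_solution f p u y"
    from is_solution_continuous[OF this] eq this
    show "continuous_on {0..} y \<and> (\<forall>t\<ge>0. y t = p + integral {0..t} (\<lambda>s. f (y s, u s)))"
      unfolding is_solution_def by simp
  next
    assume "continuous_on {0..} y \<and> (\<forall>t\<ge>0. y t = p + integral {0..t} (\<lambda>s. f (y s, u s)))"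
    then show "is_solution f p u y"
      unfolding is_solution_def using eq velocity_integrable[OF u] by simp
  qed
qed

text \<open>
  Picard iteration on the whole half-line at once: a solution is sought in the form
  \<open>exp (c t) z t\<close> with \<open>z\<close> bounded and continuous. With \<open>c = 2 L + 1\<close> the integral operator
  maps bounded continuous functions to such functions and is a contraction with factor \<open>1 / 2\<close>.
\<close>

lemma solution_exists:
  assumes u: "u \<in> controls U"
  shows "\<exists>y. is_solution f p u y"
proof -
  define c where "c = 2 * L + 1"
  have c: "c > 0" "L / c \<le> 1 / 2" using L_nonneg by (auto simp: c_def field_simps)
  obtain M where M0: "M \<ge> 0" "\<And>y a. y \<in> {0} \<Longrightarrow> a \<in> U \<Longrightarrow> norm (f (y, a)) \<le> M"
    by (rule bounded_on_compact[OF cont_f compact_sing[of 0]]) blast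
  then have M: "M \<ge> 0" "\<And>a. a \<in> U \<Longrightarrow> norm (f (0, a)) \<le> M" by blast+
  define F where "F z s = f (exp (c * s) *\<^sub>R z s, u s)" for z s
  \<comment> \<open>the Picard operator in the variable \<open>z\<close>, extended to negative times by its value at 0\<close>
  define \<Phi> where "\<Phi> z t = exp (- c * max 0 t) *\<^sub>R (p + integral {0..max 0 t} (F z))" for z t
  have int: "F z absolutely_integrable_on {0..t}" if "continuous_on UNIV z" for z t
  proof -
    have "continuous_on {0..} z" using that continuous_on_subset by blast
    then have "continuous_on {0..} (\<lambda>s. exp (c * s) *\<^sub>R z s)" by (intro continuous_intros)
    from velocity_integrable[OF u this] show ?thesis by (simp only: F_def[abs_def])
  qed
  have int': "F z integrable_on {0..t}" if "continuous_on UNIV z" for z t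
    using int[OF that] set_lebesgue_integral_eq_integral(1) by blast
  have weighted: "norm (exp (- c * t) *\<^sub>R integral {0..t} g) \<le> B / c"
    if g: "g integrable_on {0..t}" and B: "B \<ge> 0" "\<And>s. s \<in> {0..t} \<Longrightarrow> norm (g s) \<le> B * exp (c * s)"
      and t: "t \<ge> 0" for g :: "real \<Rightarrow> real^'m" and B t
  proof -
    have hi: "((\<lambda>s. B * exp (c * s)) has_integral B * ((exp (c * t) - 1) / c)) {0..t}"
      by (intro has_integral_mult_right has_integral_exp_scaled) (use c t in auto)
    have "norm (integral {0..t} g) \<le> integral {0..t} (\<lambda>s. B * exp (c * s))"
      by (rule Henstock_Kurzweil_Integration.integral_norm_bound_integral[OF g has_integral_integrable[OF hi] B(2)])
    also have "\<dots> = B * ((exp (c * t) - 1) / c)" using hi by (rule integral_unique)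
    also have "\<dots> \<le> B / c * exp (c * t)" using c B by (simp add: field_simps)
    finally have "exp (- c * t) * norm (integral {0..t} g) \<le> exp (- c * t) * (B / c * exp (c * t))"
      by (intro mult_left_mono) auto
    also have "\<dots> = B / c" by (simp add: exp_minus)
    finally show ?thesis by simp
  qed
  have bc: "\<Phi> z \<in> bcontfun" if z: "z \<in> bcontfun" for z
  proof -
    from z have zc: "continuous_on UNIV z" by (auto simp: bcontfun_def)
    from z obtain Z where Z: "\<And>s. norm (z s) \<le> Z" by (auto simp: bcontfun_def bounded_iff)
    have Z0: "Z \<ge> 0" using Z[of 0] norm_ge_zero order_trans by blast
    have "continuous_on {0..T} (\<lambda>t. integral {0..t} (F z))" for T
      by (rule indefinite_integral_continuous_1[OF int'[OF zc]])
    then have "continuous_on {0..} (\<lambda>t. integral {0..t} (F z))"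
      by (rule continuous_on_half_line)
    then have "continuous_on UNIV (\<lambda>t. integral {0..max 0 t} (F z))"
      by (rule continuous_on_compose2) (auto intro!: continuous_intros)
    then have "continuous_on UNIV (\<Phi> z)"
      unfolding \<Phi>_def by (intro continuous_intros)
    moreover have "norm (\<Phi> z t) \<le> norm p + (M + L * Z) / c" for t
    proof -
      define r where "r = max 0 t"
      have r: "r \<ge> 0" by (simp add: r_def)
      have "norm (F z s) \<le> (M + L * Z) * exp (c * s)" if "s \<in> {0..r}" for s
      proof -
        have us: "u s \<in> U" using u that by (auto simp: controls_def)
        have "norm (F z s) \<le> norm (f (0, u s)) + norm (F z s - f (0, u s))"
          by (rule norm_triangle_sub)
        also have "\<dots> \<le> M + L * norm (exp (c * s) *\<^sub>R z s)"
          unfolding F_def using M(2)[OF us] lip_fD[OF us, of "exp (c * s) *\<^sub>R z s" 0]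
          by (intro add_mono) auto
        also have "\<dots> \<le> M * exp (c * s) + L * (exp (c * s) * Z)"
        proof (intro add_mono mult_left_mono)
          have "1 \<le> exp (c * s)" using c that by simp
          then show "M \<le> M * exp (c * s)" using M(1) by (simp add: mult_le_cancel_left1)
        qed (use Z L_nonneg in auto)
        finally show ?thesis by (simp add: algebra_simps)
      qed
      from weighted[OF int'[OF zc] _ this r]
      have "norm (exp (- c * r) *\<^sub>R integral {0..r} (F z)) \<le> (M + L * Z) / c"
        using M L_nonneg Z0 by auto
      moreover have "norm (exp (- c * r) *\<^sub>R p) \<le> norm p"
        using c r by (simp add: mult_left_le_one_le)
      ultimately show ?thesis
        unfolding \<Phi>_def r_def[symmetric] scaleR_add_right by (meson add_mono norm_triangle_le)
    qed
    ultimately show ?thesis by (rule bcontfun_normI)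
  qed
  define \<Psi> :: "(real \<Rightarrow>\<^sub>C (real^'m)) \<Rightarrow> (real \<Rightarrow>\<^sub>C (real^'m))" where "\<Psi> z = Bcontfun (\<Phi> z)" for z
  have \<Psi>: "apply_bcontfun (\<Psi> z) = \<Phi> z" for z
    unfolding \<Psi>_def using bc[OF apply_bcontfun] by (rule Bcontfun_inverse)
  have "\<exists>!z. \<Psi> z = z"
  proof (rule banach_fix_type[of "1/2"])
    show "\<forall>z w. dist (\<Psi> z) (\<Psi> w) \<le> 1 / 2 * dist z w"
    proof (intro allI dist_bound)
      fix z w :: "real \<Rightarrow>\<^sub>C (real^'m)" and t :: real
      define r where "r = max 0 t"
      have r: "r \<ge> 0" by (simp add: r_def)
      have i: "F z integrable_on {0..r}" "F w integrable_on {0..r}" by (auto intro: int')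
      have "dist (apply_bcontfun (\<Psi> z) t) (apply_bcontfun (\<Psi> w) t)
          = norm (exp (- c * r) *\<^sub>R integral {0..r} (\<lambda>s. F z s - F w s))"
        unfolding \<Psi> \<Phi>_def r_def[symmetric] dist_norm
        by (simp add: Henstock_Kurzweil_Integration.integral_diff[OF i] algebra_simps)
      also have "\<dots> \<le> (L * dist z w) / c"
      proof (rule weighted[OF integrable_diff[OF i] _ _ r])
        show "0 \<le> L * dist z w" using L_nonneg by simp
        fix s assume s: "s \<in> {0..r}"
        then have us: "u s \<in> U" using u by (auto simp: controls_def)
        have "norm (F z s - F w s) \<le> L * norm (exp (c * s) *\<^sub>R z s - exp (c * s) *\<^sub>R w s)"
          unfolding F_def by (rule lip_fD[OF us])
        also have "\<dots> = L * exp (c * s) * dist (z s) (w s)"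
          by (simp add: dist_norm scaleR_diff_right[symmetric])
        also have "\<dots> \<le> L * exp (c * s) * dist z w"
          using L_nonneg by (intro mult_left_mono dist_bounded) auto
        finally show "norm (F z s - F w s) \<le> L * dist z w * exp (c * s)" by (simp add: algebra_simps)
      qed
      also have "\<dots> = (L / c) * dist z w" by simp
      also have "\<dots> \<le> 1 / 2 * dist z w" using c by (intro mult_right_mono) auto
      finally show "dist (apply_bcontfun (\<Psi> z) t) (apply_bcontfun (\<Psi> w) t) \<le> 1 / 2 * dist z w" .
    qed
  qed auto
  then obtain z where "\<Psi> z = z" by auto
  then have z: "apply_bcontfun z t = \<Phi> z t" for t using \<Psi>[of z] by simp
  define y where "y t = exp (c * t) *\<^sub>R apply_bcontfun z t" for t
  have "continuous_on {0..} y" unfolding y_def by (intro continuous_intros continuous_on_apply_bcontfun)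
  moreover have "y t = p + integral {0..t} (\<lambda>s. f (y s, u s))" if "t \<ge> 0" for t
  proof -
    have "(\<lambda>s. f (y s, u s)) = F z" by (rule ext) (simp add: y_def F_def)
    then show ?thesis
      using that unfolding y_def z[of t] by (simp add: \<Phi>_def exp_minus)
  qed
  ultimately show ?thesis using is_solution_iff[OF u] by blast
qed

lemma sol_is_solution: "u \<in> controls U \<Longrightarrow> is_solution f p u (sol f p u)"
  unfolding sol_def by (rule someI_ex[OF solution_exists])

lemma sol_continuous: "u \<in> controls U \<Longrightarrow> continuous_on {0..} (sol f p u)"
  using sol_is_solution is_solution_continuous by blast

lemma sol_eq:
  "u \<in> controls U \<Longrightarrow> t \<ge> 0 \<Longrightarrow> sol f p u t = p + integral {0..t} (\<lambda>s. f (sol f p u s, u s))"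
  using sol_is_solution is_solution_iff by blast

lemma solution_dist:
  assumes u: "u \<in> controls U" and y: "is_solution f p u y" and z: "is_solution f q u z" and t: "t \<ge> 0"
  shows "norm (y t - z t) \<le> 2 * norm (p - q) * exp ((2 * L + 1) * t)"
proof (rule gronwall_weighted[of t "\<lambda>t. norm (y t - z t)"])
  have cy: "continuous_on {0..} y" "continuous_on {0..} z"
    using y z is_solution_continuous by auto
  then have c: "continuous_on {0..r} (\<lambda>t. norm (y t - z t))" for r
    by (auto intro!: continuous_intros intro: continuous_on_subset)
  then show "continuous_on {0..t} (\<lambda>t. norm (y t - z t))" .
  fix r assume r: "r \<in> {0..t}"
  have i: "(\<lambda>s. f (y s, u s)) integrable_on {0..r}" "(\<lambda>s. f (z s, u s)) integrable_on {0..r}"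
    using cy by (auto intro: velocity_integrable_on[OF u])
  have "y r - z r = (p - q) + integral {0..r} (\<lambda>s. f (y s, u s) - f (z s, u s))"
    using y z r unfolding is_solution_iff[OF u] by (simp add: Henstock_Kurzweil_Integration.integral_diff[OF i])
  also have "norm \<dots> \<le> norm (p - q) + norm (integral {0..r} (\<lambda>s. f (y s, u s) - f (z s, u s)))"
    by (rule norm_triangle_ineq)
  also have "norm (integral {0..r} (\<lambda>s. f (y s, u s) - f (z s, u s))) \<le> integral {0..r} (\<lambda>s. L * norm (y s - z s))"
  proof (rule Henstock_Kurzweil_Integration.integral_norm_bound_integral[OF integrable_diff[OF i]])
    show "(\<lambda>s. L * norm (y s - z s)) integrable_on {0..r}"
      by (intro integrable_continuous_interval continuous_intros c)
  qed (use lip_fD u in \<open>auto simp: controls_def\<close>)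
  finally show "norm (y r - z r) \<le> norm (p - q) + L * integral {0..r} (\<lambda>s. norm (y s - z s))"
    by simp
qed (use L_nonneg t in auto)

lemma sol_unique:
  assumes "u \<in> controls U" "is_solution f p u y" "t \<ge> 0"
  shows "sol f p u t = y t"
  using solution_dist[OF assms(1) sol_is_solution[OF assms(1), of p] assms(2,3)] by simp

lemma sol_dist:
  assumes "u \<in> controls U" "t \<ge> 0"
  shows "norm (sol f p u t - sol f q u t) \<le> 2 * norm (p - q) * exp ((2 * L + 1) * t)"
  using solution_dist assms sol_is_solution by blast

lemma sol_bounded:
  assumes "bounded K"
  obtains B where "\<And>p u t. p \<in> K \<Longrightarrow> u \<in> controls U \<Longrightarrow> t \<in> {0..T} \<Longrightarrow> norm (sol f p u t) \<le> B"
proof -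
  obtain M where M0: "M \<ge> 0" "\<And>y a. y \<in> {0} \<Longrightarrow> a \<in> U \<Longrightarrow> norm (f (y, a)) \<le> M"
    by (rule bounded_on_compact[OF cont_f compact_sing[of 0]]) blast
  then have M: "M \<ge> 0" "\<And>a. a \<in> U \<Longrightarrow> norm (f (0, a)) \<le> M" by blast+
  obtain R where R: "\<And>p. p \<in> K \<Longrightarrow> norm p \<le> R" using assms by (auto simp: bounded_iff)
  define a where "a = max R 0 + M * max T 0"
  have "norm (sol f p u t) \<le> 2 * a * exp ((2 * L + 1) * T)"
    if p: "p \<in> K" and u: "u \<in> controls U" and t: "t \<in> {0..T}" for p u t
  proof -
    let ?y = "sol f p u"
    have cy: "continuous_on {0..} ?y" by (rule sol_continuous[OF u])
    then have c: "continuous_on {0..r} (\<lambda>t. norm (?y t))" for r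
      by (auto intro!: continuous_intros intro: continuous_on_subset)
    have "norm (?y t) \<le> 2 * a * exp ((2 * L + 1) * t)"
    proof (rule gronwall_weighted[OF c L_nonneg _ _ t])
      show "0 \<le> a" using M by (simp add: a_def)
      fix r assume r: "r \<in> {0..T}"
      have i: "(\<lambda>s. f (?y s, u s)) integrable_on {0..r}"
        by (rule velocity_integrable_on[OF u cy])
      have ii: "(\<lambda>s. M + L * norm (?y s)) integrable_on {0..r}"
          "(\<lambda>s. L * norm (?y s)) integrable_on {0..r}"
        by (intro integrable_continuous_interval continuous_intros c)+
      have "norm (integral {0..r} (\<lambda>s. f (?y s, u s))) \<le> integral {0..r} (\<lambda>s. M + L * norm (?y s))"
      proof (rule Henstock_Kurzweil_Integration.integral_norm_bound_integral[OF i ii(1)])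
        fix s assume "s \<in> {0..r}"
        then have us: "u s \<in> U" using u by (auto simp: controls_def)
        have "norm (f (?y s, u s)) \<le> norm (f (0, u s)) + norm (f (?y s, u s) - f (0, u s))"
          by (rule norm_triangle_sub)
        also have "\<dots> \<le> M + L * norm (?y s)"
          using M(2)[OF us] lip_fD[OF us, of "?y s" 0] by (intro add_mono) auto
        finally show "norm (f (?y s, u s)) \<le> M + L * norm (?y s)" .
      qed
      also have "\<dots> = M * r + L * integral {0..r} (\<lambda>s. norm (?y s))"
        using r by (subst Henstock_Kurzweil_Integration.integral_add) (use ii in auto)
      also have "\<dots> \<le> M * max T 0 + L * integral {0..r} (\<lambda>s. norm (?y s))"
        using r M(1) by (intro add_right_mono mult_left_mono) auto
      finally have *: "norm (integral {0..r} (\<lambda>s. f (?y s, u s)))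
          \<le> M * max T 0 + L * integral {0..r} (\<lambda>s. norm (?y s))" .
      have "norm (?y r) \<le> norm p + norm (integral {0..r} (\<lambda>s. f (?y s, u s)))"
        using r by (subst sol_eq[OF u]) (auto simp: norm_triangle_ineq)
      then show "norm (?y r) \<le> a + L * integral {0..r} (\<lambda>s. norm (?y s))"
        using * R[OF p] by (simp add: a_def)
    qed
    also have "\<dots> \<le> 2 * a * exp ((2 * L + 1) * T)"
      using t M L_nonneg by (intro mult_left_mono) (auto simp: a_def intro!: mult_left_mono)
    finally show ?thesis .
  qed
  then show ?thesis using that by blast
qed

lemma sol_displacement:
  assumes "bounded K"
  obtains C where "C > 0" "\<And>p u t. p \<in> K \<Longrightarrow> u \<in> controls U \<Longrightarrow> t \<in> {0..T} \<Longrightarrow> norm (sol f p u t - p) \<le> C * t"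
proof -
  obtain B where B: "\<And>p u t. p \<in> K \<Longrightarrow> u \<in> controls U \<Longrightarrow> t \<in> {0..T} \<Longrightarrow> norm (sol f p u t) \<le> B"
    using sol_bounded[OF assms] by metis
  obtain C where C: "C \<ge> 0" "\<And>y a. y \<in> cball 0 B \<Longrightarrow> a \<in> U \<Longrightarrow> norm (f (y, a)) \<le> C"
    by (rule bounded_on_compact[OF cont_f compact_cball[of 0 B]]) blast
  have "norm (sol f p u t - p) \<le> (C + 1) * t" if "p \<in> K" "u \<in> controls U" "t \<in> {0..T}" for p u t
  proof -
    have "norm (integral {0..t} (\<lambda>s. f (sol f p u s, u s))) \<le> integral {0..t} (\<lambda>s. C)"
    proof (rule Henstock_Kurzweil_Integration.integral_norm_bound_integral)
      show "(\<lambda>s. f (sol f p u s, u s)) integrable_on {0..t}"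
        by (rule velocity_integrable_on[OF that(2) sol_continuous[OF that(2)]])
      show "norm (f (sol f p u s, u s)) \<le> C" if "s \<in> {0..t}" for s
        using B[of p u s] \<open>p \<in> K\<close> \<open>u \<in> controls U\<close> \<open>t \<in> {0..T}\<close> that
        by (intro C(2)) (auto simp: controls_def)
    qed (rule integrable_const_ivl)
    also have "\<dots> = C * t" using that by simp
    also have "\<dots> \<le> (C + 1) * t" using that by (intro mult_right_mono) auto
    finally show ?thesis using sol_eq[OF that(2), of t p] that by simp
  qed
  then show ?thesis using that[of "C + 1"] C(1) by auto
qed

text \<open>
  The initial piece is constant because a gradient inequality at \<open>(y, a)\<close> concerns the fixed
  velocity \<open>f (y, a)\<close>. The other control restarts its clock at \<open>s\<close>.
\<close>
definition concat_control :: "real \<Rightarrow> 'u \<Rightarrow> (real \<Rightarrow> 'u) \<Rightarrow> real \<Rightarrow> 'u" where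
  "concat_control s a w = (\<lambda>t. if t \<le> s then a else w (t - s))"

lemma concat_control_in:
  assumes a: "a \<in> U" and w: "w \<in> controls U" and s: "s \<ge> 0"
  shows "concat_control s a w \<in> controls U"
proof -
  have "concat_control s a w \<in> measurable (lebesgue_on {0..}) borel"
  proof (rule measurableI)
    fix A :: "'u set" assume A: "A \<in> sets borel"
    have wm: "w \<in> measurable (lebesgue_on {0..}) borel" using w by (simp add: controls_def)
    from measurable_sets[OF wm A] have wA: "w -` A \<inter> {0..} \<in> sets lebesgue"
      by (subst (asm) sets_restrict_space_iff) auto
    from lebesgue_sets_translation[OF wA, of s] have "(+) s ` (w -` A \<inter> {0..}) \<in> sets lebesgue" .
    then have S: "(+) s ` (w -` A \<inter> {0..}) \<inter> {s<..} \<in> sets lebesgue"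
      by (rule sets.Int) (simp add: borel_open)
    have "concat_control s a w -` A \<inter> space (lebesgue_on {0..}) =
      (if a \<in> A then {0..s} else {}) \<union> ((+) s ` (w -` A \<inter> {0..}) \<inter> {s<..})"
    proof (intro set_eqI)
      fix t
      have "t \<in> (+) s ` (w -` A \<inter> {0..}) \<longleftrightarrow> t - s \<in> w -` A \<inter> {0..}"
        by (auto simp: image_iff intro!: bexI[of _ "t - s"])
      then show "t \<in> concat_control s a w -` A \<inter> space (lebesgue_on {0..}) \<longleftrightarrow>
        t \<in> (if a \<in> A then {0..s} else {}) \<union> ((+) s ` (w -` A \<inter> {0..}) \<inter> {s<..})"
        using s by (cases "t \<le> s") (auto simp: concat_control_def)
    qed
    moreover have "\<dots> \<in> sets lebesgue" by (intro sets.Un S) auto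
    ultimately show "concat_control s a w -` A \<inter> space (lebesgue_on {0..}) \<in> sets (lebesgue_on {0..})"
      by (subst sets_restrict_space_iff) auto
  qed auto
  then show ?thesis using a w by (auto simp: controls_def concat_control_def)
qed

lemma sol_concat:
  assumes a: "a \<in> U" and w: "w \<in> controls U" and s: "s \<ge> 0" and t: "t \<ge> 0"
  shows "sol f p (concat_control s a w) t =
    (if t \<le> s then sol f p (\<lambda>_. a) t else sol f (sol f p (\<lambda>_. a) s) w (t - s))"
proof -
  let ?u = "concat_control s a w"
  define x where "x = sol f p (\<lambda>_. a)"
  define z where "z = sol f (x s) w"
  define y where "y t = (if t \<le> s then x t else z (t - s))" for t
  note ca = const_control[OF a] and cu = concat_control_in[OF a w s]
  have z0: "z 0 = x s" unfolding z_def by (subst sol_eq[OF w]) auto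
  have xc: "continuous_on {0..} x" and zc: "continuous_on {0..} z"
    unfolding x_def z_def by (intro sol_continuous ca w)+
  have yc: "continuous_on {0..} y"
  proof -
    have "continuous_on ({0..s} \<union> {s..}) (\<lambda>t. if t \<le> s then x t else z (t - s))"
      by (rule continuous_on_If) 
         (use s z0 in \<open>auto intro!: continuous_on_subset[OF xc] continuous_on_compose2[OF zc] continuous_intros\<close>)
    moreover have "{0..s} \<union> {s..} = {0..}" using s by auto
    ultimately show ?thesis by (simp add: y_def[abs_def])
  qed
  have "y t = p + integral {0..t} (\<lambda>r. f (y r, ?u r))" if t: "t \<ge> 0" for t
  proof (cases "t \<le> s")
    case True
    have "integral {0..t} (\<lambda>r. f (y r, ?u r)) = integral {0..t} (\<lambda>r. f (x r, a))"
      by (rule Henstock_Kurzweil_Integration.integral_cong) (use True in \<open>auto simp: y_def concat_control_def\<close>)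
    then show ?thesis using True sol_eq[OF ca t, of p] by (simp add: y_def x_def)
  next
    case False
    have "integral {0..t} (\<lambda>r. f (y r, ?u r)) =
       integral {0..s} (\<lambda>r. f (x r, a)) + integral {0..t - s} (\<lambda>r. f (z r, w r))"
      by (rule integral_concat)
        (use False s velocity_integrable_on[OF cu yc]
          in \<open>auto simp: y_def concat_control_def\<close>)
    moreover have "x s = p + integral {0..s} (\<lambda>r. f (x r, a))"
      unfolding x_def by (rule sol_eq[OF ca s])
    moreover have "z (t - s) = x s + integral {0..t - s} (\<lambda>r. f (z r, w r))"
      unfolding z_def by (rule sol_eq[OF w]) (use False in auto)
    ultimately show ?thesis using False by (simp add: y_def)
  qed
  then have "is_solution f p ?u y" using yc is_solution_iff[OF cu] by blast
  from sol_unique[OF cu this t] show ?thesis by (simp add: y_def z_def x_def)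
qed

end

section \<open>Smoothing and Lipschitz approximation\<close>

lemma grad_eq: "GDERIV \<phi> x :> d \<Longrightarrow> grad \<phi> x = d"
  for \<phi> :: "real^'m \<Rightarrow> real"
  unfolding grad_def
proof (rule the_equality)
  fix d' assume *: "GDERIV \<phi> x :> d" "GDERIV \<phi> x :> d'"
  then have "(\<lambda>h. h \<bullet> d) = (\<lambda>h. h \<bullet> d')"
    unfolding gderiv_def by (rule has_derivative_unique)
  then show "d' = d" by (metis vector_eq_ldot)
qed

lemma C1_grad:
  assumes "C1 \<phi>"
  shows "continuous_on UNIV \<phi>" "continuous_on UNIV (grad \<phi>)"
proof -
  obtain g where g: "\<And>x. GDERIV \<phi> x :> g x" "continuous_on UNIV g"
    using assms by (auto simp: C1_def)
  have "grad \<phi> = g" using grad_eq[OF g(1)] by auto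
  then show "continuous_on UNIV (grad \<phi>)" using g by simp
  show "continuous_on UNIV \<phi>"
    by (rule has_derivative_continuous_on[where f' = "\<lambda>x h. h \<bullet> g x"])
      (use g(1) in \<open>simp add: gderiv_def\<close>)
qed

text \<open>
  A squared positive part is continuously differentiable; this is all the smoothness that is
  asked of the kernel. It is left unnormalised.
\<close>
definition bump :: "real \<Rightarrow> 'a::euclidean_space \<Rightarrow> real" where
  "bump r w = (max 0 (r\<^sup>2 - w \<bullet> w))\<^sup>2"

definition bump_grad :: "real \<Rightarrow> 'a::euclidean_space \<Rightarrow> 'a" where
  "bump_grad r w = (- 4 * max 0 (r\<^sup>2 - w \<bullet> w)) *\<^sub>R w"

lemma pos_part_square_deriv: "DERIV (\<lambda>t::real. (max 0 t)\<^sup>2) t :> 2 * max 0 t"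
proof -
  consider "t > 0" | "t < 0" | "t = 0" by linarith
  then show ?thesis
  proof cases
    case 1
    have "DERIV (\<lambda>t::real. t\<^sup>2) t :> 2 * max 0 t"
      using 1 by (auto intro!: derivative_eq_intros)
    then show ?thesis
      by (rule has_field_derivative_transform_within_open[of _ _ _ "{0<..}"]) (use 1 in auto)
  next
    case 2
    have "DERIV (\<lambda>t::real. 0) t :> 2 * max 0 t"
      using 2 by (auto intro!: derivative_eq_intros)
    then show ?thesis
      by (rule has_field_derivative_transform_within_open[of _ _ _ "{..<0}"]) (use 2 in auto)
  next
    case 3
    have "((\<lambda>h::real. (max 0 h)\<^sup>2 / h) \<longlongrightarrow> 0) (at 0)"
    proof (rule Lim_null_comparison)
      show "((\<lambda>h::real. \<bar>h\<bar>) \<longlongrightarrow> 0) (at 0)" by (intro tendsto_rabs_zero tendsto_ident_at)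
      show "\<forall>\<^sub>F h::real in at 0. norm ((max 0 h)\<^sup>2 / h) \<le> \<bar>h\<bar>"
        by (intro always_eventually allI) (auto simp: max_def power2_eq_square)
    qed
    then show ?thesis using 3 by (simp add: DERIV_def)
  qed
qed

lemma bump_has_derivative: "(bump r has_derivative (\<lambda>h. h \<bullet> bump_grad r w)) (at w)"
proof -
  have "((\<lambda>w. r\<^sup>2 - w \<bullet> w) has_derivative (\<lambda>h. - 2 * (h \<bullet> w))) (at w)"
    by (auto intro!: derivative_eq_intros simp: inner_commute)
  from DERIV_compose_FDERIV[OF pos_part_square_deriv this]
  show ?thesis unfolding bump_def[abs_def] bump_grad_def
    by (rule has_derivative_eq_rhs) auto
qed

lemma continuous_on_bump: "continuous_on A g \<Longrightarrow> continuous_on A (\<lambda>x. bump r (g x))"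
  unfolding bump_def by (intro continuous_intros)

lemma bump_nonneg: "bump r w \<ge> 0"
  by (simp add: bump_def)

lemma bump_eq_0: "r \<ge> 0 \<Longrightarrow> norm w \<ge> r \<Longrightarrow> bump r w = 0"
  using power_mono[of r "norm w" 2] by (simp add: bump_def power2_norm_eq_inner)

text \<open>
  The convolution of \<open>G\<close> with a bump of radius \<open>r\<close>. Near \<open>Y\<close> it can be read in two ways: with the
  variable in the bump, which shows that it is differentiable, and with the variable in \<open>G\<close>, which
  shows that it is an average of translates of \<open>G\<close>. By the second reading a lower bound for
  difference quotients of \<open>G\<close> at all points of the ball of radius \<open>r\<close> about \<open>y\<close> passes to the
  average, and then to its derivative at \<open>y\<close>.
\<close>

lemma mollification:
  fixes G :: "real^'m \<Rightarrow> real"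
  assumes Y: "bounded Y" and G: "K-lipschitz_on UNIV G" and r: "r > 0"
  obtains \<phi> where "C1 \<phi>" "\<And>y. y \<in> Y \<Longrightarrow> \<bar>\<phi> y - G y\<bar> \<le> K * r"
    "\<And>y v c s0. y \<in> Y \<Longrightarrow> s0 > 0 \<Longrightarrow>
       (\<And>p s. norm (p - y) \<le> r \<Longrightarrow> 0 < s \<Longrightarrow> s \<le> s0 \<Longrightarrow> G (p + s *\<^sub>R v) - G p \<ge> s * c) \<Longrightarrow>
       grad \<phi> y \<bullet> v \<ge> c"
proof -
  define e :: "real^'m" where "e = r *\<^sub>R One"
  define B where "B = cbox (- e) e"
  have supp: "bump r w = 0" if "w \<notin> B" for w :: "real^'m"
  proof (rule bump_eq_0)
    from that obtain i where i: "i \<in> Basis" "\<bar>w \<bullet> i\<bar> > r"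
      unfolding B_def e_def mem_box using r
      by (fastforce simp: abs_less_iff not_le inner_sum_left inner_Basis if_distrib sum.delta cong: if_cong)
    show "norm w \<ge> r" using Basis_le_norm[OF i(1), of w] i(2) by linarith
  qed (use r in auto)
  have contG: "continuous_on A G" for A
    using lipschitz_on_continuous_on[OF G] continuous_on_subset by blast
  have contG': "continuous_on A (\<lambda>x. G (g x))" if "continuous_on A g" for A and g :: "real^'m \<Rightarrow> real^'m"
    by (rule continuous_on_compose2[OF contG that]) auto
  obtain R where R: "\<And>y. y \<in> Y \<Longrightarrow> norm y \<le> R" using Y by (auto simp: bounded_iff)
  obtain E where E: "\<And>w. w \<in> B \<Longrightarrow> norm w \<le> E"
    using bounded_cbox[of "-e" e] by (auto simp: B_def bounded_iff)
  obtain b where b: "cball (0::real^'m) (R + 1 + E) \<subseteq> cbox (- b) b"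
    using bounded_subset_cbox_symmetric[OF bounded_cball] by blast
  define I where "I = integral B (bump r)"
  have intB: "g integrable_on B" if "continuous_on B g" for g :: "real^'m \<Rightarrow> real"
    using that unfolding B_def by (rule integrable_continuous)
  have cbump: "continuous_on A (bump r)" for A :: "(real^'m) set"
    using continuous_on_bump[OF continuous_on_id] by simp
  have I: "I > 0"
  proof (rule ccontr)
    assume "\<not> I > 0"
    moreover have "I \<ge> 0" unfolding I_def
      by (rule Henstock_Kurzweil_Integration.integral_nonneg[OF intB[OF cbump]]) (rule bump_nonneg)
    ultimately have "I = 0" by simp
    then have "(bump r has_integral 0) (cbox (- e) e)"
      using integrable_integral[OF intB[OF cbump]] by (simp add: I_def B_def)
    moreover have "0 \<in> box (- e) e" using r by (auto simp: e_def mem_box)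
    ultimately have "bump r (0::real^'m) = 0"
      using box_subset_cbox[of "- e" e]
      by (intro has_integral_0_cbox_imp_0[of "- e" e "bump r"] cbump bump_nonneg) auto
    then show False using r by (simp add: bump_def)
  qed
  \<comment> \<open>A fixed box of integration, large enough for all points at distance at most 1 from \<open>Y\<close>,
    gives a function that is \<open>C1\<close> everywhere by differentiation under the integral sign.\<close>
  define \<phi> where "\<phi> y = (1 / I) * integral (cbox (- b) b) (\<lambda>z. bump r (z - y) * G z)" for y
  have \<phi>: "\<phi> y = (1 / I) * integral B (\<lambda>w. bump r w * G (w + y))" if "norm y \<le> R + 1" for y
  proof -
    let ?h = "\<lambda>z. bump r (z - y) * G z"
    have sub: "cbox (- e + y) (e + y) \<subseteq> cbox (- b) b"
    proof
      fix z assume "z \<in> cbox (- e + y) (e + y)"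
      then have "z - y \<in> B" by (auto simp: B_def mem_box algebra_simps)
      then have "norm (z - y) \<le> E" by (rule E)
      then have "norm z \<le> R + 1 + E" using that norm_triangle_sub[of z y] by linarith
      then show "z \<in> cbox (- b) b" using b by auto
    qed
    have "?h integrable_on cbox (- e + y) (e + y)"
      by (intro integrable_continuous continuous_intros continuous_on_bump contG)
    then have "(?h has_integral integral (cbox (- e + y) (e + y)) ?h) (cbox (- e + y) (e + y))"
      by (rule integrable_integral)
    then have "(?h has_integral integral (cbox (- e + y) (e + y)) ?h) (cbox (- b) b)"
    proof (rule has_integral_on_superset[OF _ _ sub])
      fix z assume "z \<notin> cbox (- e + y) (e + y)"
      then have "z - y \<notin> B" by (auto simp: B_def mem_box algebra_simps)
      then show "?h z = 0" using supp by simp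
    qed
    then have "integral (cbox (- b) b) ?h = integral (cbox (- e + y) (e + y)) ?h"
      by (rule integral_unique)
    also have "\<dots> = integral B (\<lambda>w. bump r w * G (w + y))"
      using integral_shift_cbox[of "- e + y" y "e + y" ?h] by (simp add: B_def)
    finally show ?thesis by (simp add: \<phi>_def)
  qed
  have intBG: "(\<lambda>w. bump r w * G (w + y)) integrable_on B" for y
    by (intro intB continuous_intros cbump contG')
  have intBc: "(\<lambda>w. bump r w * c) integrable_on B" for c
    by (intro intB continuous_intros cbump)
  have Ic: "integral B (\<lambda>w. bump r w * c) = I * c" for c
    unfolding I_def by simp
  define g where "g y = (1 / I) *\<^sub>R integral (cbox (- b) b) (\<lambda>z. (- G z) *\<^sub>R bump_grad r (z - y))" for y
  have cg: "continuous_on (UNIV \<times> cbox (- b) b) (\<lambda>(y, z). (- G z) *\<^sub>R bump_grad r (z - y))"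
    unfolding split_beta bump_grad_def
    by (intro continuous_intros continuous_on_compose2[OF contG[of UNIV]]) auto
  have gderiv: "GDERIV \<phi> y :> g y" for y
  proof -
    define fx where "fx y z = blinfun_inner_left ((- G z) *\<^sub>R bump_grad r (z - y))" for y z
    have "((\<lambda>y. integral (cbox (- b) b) (\<lambda>z. bump r (z - y) * G z)) has_derivative
        integral (cbox (- b) b) (fx y)) (at y within UNIV)"
    proof (rule leibniz_rule)
      fix x z :: "real^'m"
      have "((\<lambda>x. z - x) has_derivative (\<lambda>h. - h)) (at x)"
        by (auto intro!: derivative_eq_intros)
      from has_derivative_compose[OF this bump_has_derivative[of r "z - x"]]
      have "((\<lambda>x. bump r (z - x)) has_derivative (\<lambda>h. - h \<bullet> bump_grad r (z - x))) (at x)" .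
      from has_derivative_mult_left[OF this, of "G z"]
      show "((\<lambda>x. bump r (z - x) * G z) has_derivative blinfun_apply (fx x z)) (at x within UNIV)"
        by (rule has_derivative_eq_rhs) (auto simp: fx_def)
    next
      fix x show "(\<lambda>z. bump r (z - x) * G z) integrable_on cbox (- b) b"
        by (intro integrable_continuous continuous_intros continuous_on_bump contG)
    next
      have "continuous_on (UNIV \<times> cbox (- b) b)
         (\<lambda>p. blinfun_inner_left ((\<lambda>(y, z). (- G z) *\<^sub>R bump_grad r (z - y)) p))"
        by (rule bounded_linear.continuous_on[OF bounded_linear_blinfun_inner_left cg])
      then show "continuous_on (UNIV \<times> cbox (- b) b) (\<lambda>(x, t). fx x t)"
        by (simp add: fx_def split_beta)
    qed auto
    then have "(\<phi> has_derivative (\<lambda>h. (1 / I) * blinfun_apply (integral (cbox (- b) b) (fx y)) h)) (at y)"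
      unfolding \<phi>_def[abs_def] by (intro has_derivative_mult_right) simp
    moreover have "integral (cbox (- b) b) (fx y) =
        blinfun_inner_left (integral (cbox (- b) b) (\<lambda>z. (- G z) *\<^sub>R bump_grad r (z - y)))"
    proof -
      have "continuous_on (cbox (- b) b) (\<lambda>z. (- G z) *\<^sub>R bump_grad r (z - y))"
        unfolding bump_grad_def by (intro continuous_intros contG)
      from integral_linear[OF integrable_continuous[OF this] bounded_linear_blinfun_inner_left]
      show ?thesis by (simp add: fx_def[abs_def] o_def)
    qed
    ultimately show ?thesis
      unfolding gderiv_def by (rule_tac has_derivative_eq_rhs) (auto simp: g_def)
  qed
  have "continuous_on UNIV g"
    unfolding g_def by (intro continuous_intros integral_continuous_on_param cg)
  then have C1: "C1 \<phi>" using gderiv by (auto simp: C1_def)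
  have close: "\<bar>\<phi> y - G y\<bar> \<le> K * r" if y: "y \<in> Y" for y
  proof -
    have "\<phi> y - G y = (1 / I) * (integral B (\<lambda>w. bump r w * G (w + y)) - I * G y)"
      using I \<phi>[of y] R[OF y] by (simp add: field_simps)
    also have "\<dots> = (1 / I) * integral B (\<lambda>w. bump r w * G (w + y) - bump r w * G y)"
      by (subst Henstock_Kurzweil_Integration.integral_diff[OF intBG intBc]) (simp add: I_def)
    finally have "\<bar>\<phi> y - G y\<bar> = (1 / I) * norm (integral B (\<lambda>w. bump r w * G (w + y) - bump r w * G y))"
      using I by (simp add: abs_mult)
    also have "\<dots> \<le> (1 / I) * integral B (\<lambda>w. bump r w * (K * r))"
    proof (intro mult_left_mono Henstock_Kurzweil_Integration.integral_norm_bound_integral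
        integrable_diff intBG intBc)
      fix w :: "real^'m"
      show "norm (bump r w * G (w + y) - bump r w * G y) \<le> bump r w * (K * r)"
      proof (cases "norm w < r")
        case True
        have "\<bar>G (w + y) - G y\<bar> \<le> K * norm w"
          using lipschitz_on_normD[OF G, of "w + y" y] by simp
        also have "\<dots> \<le> K * r" using True lipschitz_on_nonneg[OF G] by (intro mult_left_mono) auto
        finally show ?thesis
          unfolding right_diff_distrib[symmetric] real_norm_def abs_mult abs_of_nonneg[OF bump_nonneg] by (rule mult_left_mono[OF _ bump_nonneg])
      qed (use r bump_eq_0[of r w] in auto)
    qed (use I in auto)
    finally show ?thesis using I unfolding Ic by simp
  qed
  have lower: "grad \<phi> y \<bullet> v \<ge> c"
    if y: "y \<in> Y" and s0: "s0 > 0"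
      and inc: "\<And>p s. norm (p - y) \<le> r \<Longrightarrow> 0 < s \<Longrightarrow> s \<le> s0 \<Longrightarrow> G (p + s *\<^sub>R v) - G p \<ge> s * c"
    for y v c s0
  proof -
    have quot: "(\<phi> (y + s *\<^sub>R v) - \<phi> y) / s \<ge> c" if s: "0 < s" "s \<le> s0" "s * norm v \<le> 1" for s
    proof -
      have n: "norm y \<le> R + 1" "norm (y + s *\<^sub>R v) \<le> R + 1"
        using R[OF y] s norm_triangle_ineq[of y "s *\<^sub>R v"] by auto
      have "I * (s * c) = integral B (\<lambda>w. bump r w * (s * c))" by (rule Ic[symmetric])
      also have "\<dots> \<le> integral B (\<lambda>w. bump r w * G (w + (y + s *\<^sub>R v)) - bump r w * G (w + y))"
      proof (intro integral_le integrable_diff intBG intBc)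
        fix w :: "real^'m"
        show "bump r w * (s * c) \<le> bump r w * G (w + (y + s *\<^sub>R v)) - bump r w * G (w + y)"
        proof (cases "norm w < r")
          case True
          then have "s * c \<le> G ((w + y) + s *\<^sub>R v) - G (w + y)"
            using s by (intro inc) auto
          then show ?thesis
            unfolding right_diff_distrib[symmetric]
            by (intro mult_left_mono) (auto simp: bump_nonneg add.assoc)
        qed (use r bump_eq_0[of r w] in auto)
      qed
      also have "\<dots> = I * (\<phi> (y + s *\<^sub>R v) - \<phi> y)"
        using I \<phi>[OF n(1)] \<phi>[OF n(2)]
        by (subst Henstock_Kurzweil_Integration.integral_diff[OF intBG intBG]) (simp add: field_simps)
      finally have "s * c \<le> \<phi> (y + s *\<^sub>R v) - \<phi> y"
        using I by (rule mult_left_le_imp_le)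
      then show ?thesis using s by (simp add: field_simps)
    qed
    have D: "((\<lambda>s. \<phi> (y + s *\<^sub>R v)) has_derivative (\<lambda>s. (s *\<^sub>R v) \<bullet> g y)) (at 0)"
    proof -
      have 1: "((\<lambda>s. y + s *\<^sub>R v) has_derivative (\<lambda>s. s *\<^sub>R v)) (at (0::real))"
        by (auto intro!: derivative_eq_intros)
      have 2: "(\<phi> has_derivative (\<lambda>h. h \<bullet> g y)) (at (y + 0 *\<^sub>R v))"
        using gderiv[of y] by (simp add: gderiv_def)
      show ?thesis using has_derivative_compose[OF 1 2] by simp
    qed
    have "(\<lambda>s. (s *\<^sub>R v) \<bullet> g y) = (*) (v \<bullet> g y)"
      by (auto simp: mult.commute)
    with D have "DERIV (\<lambda>s. \<phi> (y + s *\<^sub>R v)) 0 :> v \<bullet> g y"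
      unfolding has_field_derivative_def by simp
    then have "((\<lambda>s. (\<phi> (y + s *\<^sub>R v) - \<phi> y) / s) \<longlongrightarrow> v \<bullet> g y) (at 0)"
      by (simp add: DERIV_def)
    then have lim: "((\<lambda>s. (\<phi> (y + s *\<^sub>R v) - \<phi> y) / s) \<longlongrightarrow> v \<bullet> g y) (at_right 0)"
      by (rule tendsto_within_subset) auto
    have "\<forall>\<^sub>F s in at_right 0. c \<le> (\<phi> (y + s *\<^sub>R v) - \<phi> y) / s"
    proof -
      define s1 where "s1 = min s0 (1 / (norm v + 1))"
      have s1: "s1 > 0" using s0 by (auto simp: s1_def intro!: divide_pos_pos add_nonneg_pos)
      have "c \<le> (\<phi> (y + s *\<^sub>R v) - \<phi> y) / s" if "0 < s" "s < s1" for s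
      proof (rule quot)
        have "s * (norm v + 1) \<le> 1"
          using that pos_less_divide_eq[of "norm v + 1" s 1] norm_ge_zero[of v] by (simp add: s1_def)
        then show "s * norm v \<le> 1" using that by (simp add: algebra_simps)
      qed (use that in \<open>auto simp: s1_def\<close>)
      then show ?thesis using s1 unfolding eventually_at_right_field by auto
    qed
    from tendsto_lowerbound[OF lim this] have "c \<le> v \<bullet> g y" by simp
    then show ?thesis using grad_eq[OF gderiv[of y]] by (simp add: inner_commute)
  qed
  show ?thesis
  proof (rule that[OF C1])
    show "\<bar>\<phi> y - G y\<bar> \<le> K * r" if "y \<in> Y" for y using that by (rule close)
    show "grad \<phi> y \<bullet> v \<ge> c"
      if "y \<in> Y" "s0 > 0" "\<And>p s. norm (p - y) \<le> r \<Longrightarrow> 0 < s \<Longrightarrow> s \<le> s0 \<Longrightarrow> G (p + s *\<^sub>R v) - G p \<ge> s * c"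
      for y v c s0
      using that by (rule lower)
  qed
qed

lemma lipschitz_on_cINF:
  fixes J :: "'b \<Rightarrow> 'a::metric_space \<Rightarrow> real"
  assumes A: "A \<noteq> {}" and J: "\<And>w. w \<in> A \<Longrightarrow> K-lipschitz_on S (J w)"
    and bdd: "\<And>x. x \<in> S \<Longrightarrow> bdd_below ((\<lambda>w. J w x) ` A)"
  shows "K-lipschitz_on S (\<lambda>x. INF w\<in>A. J w x)"
proof (rule lipschitz_onI)
  have half: "(INF w\<in>A. J w x) - K * dist x y \<le> (INF w\<in>A. J w y)" if "x \<in> S" "y \<in> S" for x y
  proof (rule cINF_greatest[OF A])
    fix w assume w: "w \<in> A"
    have "(INF w\<in>A. J w x) \<le> J w x" by (rule cINF_lower[OF bdd[OF that(1)] w])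
    then show "(INF w\<in>A. J w x) - K * dist x y \<le> J w y"
      using lipschitz_onD[OF J[OF w] that] by (simp add: dist_real_def abs_le_iff)
  qed
  show "dist (INF w\<in>A. J w x) (INF w\<in>A. J w y) \<le> K * dist x y" if "x \<in> S" "y \<in> S" for x y
    using half[OF that] half[OF that(2,1)] by (simp add: dist_real_def dist_commute abs_le_iff)
  show "0 \<le> K" using A J lipschitz_on_nonneg by blast
qed

text \<open>
  At each point take the best upper bound that the values on \<open>N\<close> and the constant \<open>K\<close> impose. On \<open>N\<close>
  it is attained at the point itself, and an infimum of \<open>K\<close>-Lipschitz functions is \<open>K\<close>-Lipschitz.
\<close>

lemma mcshane_extension:
  fixes g :: "'a::metric_space \<Rightarrow> real"
  assumes g: "K-lipschitz_on N g"
  obtains G where "K-lipschitz_on UNIV G" "\<And>x. x \<in> N \<Longrightarrow> G x = g x"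
proof (cases "N = {}")
  case True
  have "K-lipschitz_on UNIV (\<lambda>_. 0::real)"
    using lipschitz_on_nonneg[OF g] by (auto simp: lipschitz_on_def)
  then show ?thesis using that True by auto
next
  case False
  define G where "G x = (INF z\<in>N. g z + K * dist x z)" for x
  have K: "K \<ge> 0" using lipschitz_on_nonneg[OF g] .
  have lip: "g x \<le> g z + K * dist x z" if "x \<in> N" "z \<in> N" for x z
    using lipschitz_onD[OF g that] by (auto simp: dist_real_def abs_le_iff)
  have bdd: "bdd_below ((\<lambda>z. g z + K * dist x z) ` N)" for x
  proof -
    obtain z0 where z0: "z0 \<in> N" using False by auto
    have "g z0 - K * dist x z0 \<le> g z + K * dist x z" if "z \<in> N" for z
    proof -
      have "K * dist z0 z \<le> K * (dist x z0 + dist x z)"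
        using K by (intro mult_left_mono) (simp_all add: dist_triangle3)
      then show ?thesis using lip[OF z0 that] by (simp add: algebra_simps)
    qed
    then show ?thesis by (intro bdd_belowI2)
  qed
  have "K-lipschitz_on UNIV G"
    unfolding G_def
  proof (rule lipschitz_on_cINF[OF False _ bdd])
    fix z
    show "K-lipschitz_on UNIV (\<lambda>x. g z + K * dist x z)"
    proof (rule lipschitz_onI[OF _ K])
      fix x y
      have "\<bar>dist x z - dist y z\<bar> \<le> dist x y"
        using dist_triangle[of x z y] dist_triangle[of y z x] by (simp add: abs_le_iff dist_commute)
      then have "K * \<bar>dist x z - dist y z\<bar> \<le> K * dist x y" using K by (rule mult_left_mono)
      then show "dist (g z + K * dist x z) (g z + K * dist y z) \<le> K * dist x y"
        using K by (simp add: dist_real_def right_diff_distrib[symmetric] abs_mult)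
    qed
  qed
  moreover have "G x = g x" if "x \<in> N" for x
  proof (rule antisym)
    show "G x \<le> g x" using cINF_lower[OF bdd that, of x] by (simp add: G_def)
    show "g x \<le> G x" unfolding G_def by (rule cINF_greatest[OF False lip[OF that]])
  qed
  ultimately show ?thesis using that by blast
qed

text \<open>
  On the product of a ball and \<open>U\<close> the Lipschitz functions form an algebra that separates points,
  so they are dense by the Stone-Weierstrass theorem. Composing with the projection onto the ball,
  which is 1-Lipschitz, makes the approximant Lipschitz and bounded for all states.
\<close>

lemma lipschitz_approximation:
  fixes k :: "'a::euclidean_space \<times> 'u::metric_space \<Rightarrow> real"
  assumes U: "compact U" and k: "continuous_on (UNIV \<times> U) k" and e: "e > 0"
  obtains k' K M where "continuous_on (UNIV \<times> U) k'"
    "\<And>a. a \<in> U \<Longrightarrow> K-lipschitz_on UNIV (\<lambda>y. k' (y, a))"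
    "\<And>y a. a \<in> U \<Longrightarrow> \<bar>k' (y, a)\<bar> \<le> M"
    "\<And>y a. norm y \<le> R \<Longrightarrow> a \<in> U \<Longrightarrow> \<bar>k' (y, a) - k (y, a)\<bar> \<le> e"
proof -
  define D where "D = cball (0::'a) (max R 0)"
  define S where "S = D \<times> U"
  have S: "compact S" using U by (auto simp: S_def D_def intro: compact_Times)
  define lips where "lips = {g::'a \<times> 'u \<Rightarrow> real. \<exists>K. K-lipschitz_on S g}"
  interpret function_ring_on lips S
  proof
    show "compact S" by (rule S)
    show cont: "continuous_on S g" if "g \<in> lips" for g
      using that lipschitz_on_continuous_on by (auto simp: lips_def)
    show "(\<lambda>x. g x + h x) \<in> lips" if gh: "g \<in> lips" "h \<in> lips" for g h
      using gh unfolding lips_def by (auto intro: lipschitz_on_add)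
    show "(\<lambda>x. g x * h x) \<in> lips" if gh: "g \<in> lips" "h \<in> lips" for g h
    proof -
      obtain A where A: "\<And>x. x \<in> S \<Longrightarrow> \<bar>g x\<bar> \<le> A"
        using compact_imp_bounded[OF compact_continuous_image[OF cont[OF gh(1)] S]]
        by (auto simp: bounded_iff)
      obtain B where B: "\<And>x. x \<in> S \<Longrightarrow> \<bar>h x\<bar> \<le> B"
        using compact_imp_bounded[OF compact_continuous_image[OF cont[OF gh(2)] S]]
        by (auto simp: bounded_iff)
      obtain K1 K2 where K: "K1-lipschitz_on S g" "K2-lipschitz_on S h"
        using gh by (auto simp: lips_def)
      have "(max A 0 * K2 + max B 0 * K1)-lipschitz_on S (\<lambda>x. g x * h x)"
      proof (rule lipschitz_onI)
        fix x y assume xy: "x \<in> S" "y \<in> S"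
        have "\<bar>g x * h x - g y * h y\<bar> = \<bar>g x * (h x - h y) + h y * (g x - g y)\<bar>"
          by (simp add: algebra_simps)
        also have "\<dots> \<le> \<bar>g x\<bar> * \<bar>h x - h y\<bar> + \<bar>h y\<bar> * \<bar>g x - g y\<bar>"
          by (metis abs_mult abs_triangle_ineq)
        also have "\<dots> \<le> max A 0 * (K2 * dist x y) + max B 0 * (K1 * dist x y)"
          using A[OF xy(1)] B[OF xy(2)] lipschitz_onD[OF K(1) xy] lipschitz_onD[OF K(2) xy]
          by (intro add_mono mult_mono) (auto simp: dist_real_def)
        finally show "dist (g x * h x) (g y * h y) \<le> (max A 0 * K2 + max B 0 * K1) * dist x y"
          by (simp add: dist_real_def algebra_simps)
      qed (use lipschitz_on_nonneg[OF K(1)] lipschitz_on_nonneg[OF K(2)] in auto)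
      then show ?thesis by (auto simp: lips_def)
    qed
    show "(\<lambda>_. c) \<in> lips" for c by (auto simp: lips_def lipschitz_on_def)
    show "\<exists>g\<in>lips. g x \<noteq> g y" if "x \<in> S" "y \<in> S" "x \<noteq> y" for x y
    proof (intro bexI[of _ "\<lambda>z. dist z x"])
      have "1-lipschitz_on S (\<lambda>z. dist z x)"
        by (rule lipschitz_onI) (auto simp: dist_real_def abs_le_iff algebra_simps dist_triangle, metis dist_commute dist_triangle)
      then show "(\<lambda>z. dist z x) \<in> lips" by (auto simp: lips_def)
    qed (use that in auto)
  qed
  have kS: "continuous_on S k" by (rule continuous_on_subset[OF k]) (auto simp: S_def)
  obtain g where g: "g \<in> lips" "\<And>x. x \<in> S \<Longrightarrow> \<bar>k x - g x\<bar> < e"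
    using Stone_Weierstrass_basic[OF kS e] by auto
  obtain K where K: "K-lipschitz_on S g" using g(1) by (auto simp: lips_def)
  have gc: "continuous_on S g" using lipschitz_on_continuous_on[OF K] .
  obtain M where M: "\<And>x. x \<in> S \<Longrightarrow> \<bar>g x\<bar> \<le> M"
    using compact_imp_bounded[OF compact_continuous_image[OF gc S]] by (auto simp: bounded_iff)
  define P where "P = closest_point D"
  have D: "convex D" "closed D" "D \<noteq> {}" by (auto simp: D_def)
  have PD: "P y \<in> D" for y unfolding P_def by (rule closest_point_in_set[OF D(2,3)])
  have Plip: "dist (P x) (P y) \<le> dist x y" for x y
    unfolding P_def by (rule closest_point_lipschitz[OF D])
  have Pid: "P y = y" if "norm y \<le> R" for y
    unfolding P_def by (rule closest_point_self) (use that in \<open>auto simp: D_def\<close>)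
  have Pc: "continuous_on UNIV P"
    unfolding P_def by (rule continuous_on_closest_point[OF D])
  show ?thesis
  proof (rule that[of "\<lambda>z. g (P (fst z), snd z)" K M])
    show "continuous_on (UNIV \<times> U) (\<lambda>z. g (P (fst z), snd z))"
      by (rule continuous_on_compose2[OF gc])
        (use PD in \<open>auto simp: S_def intro!: continuous_intros continuous_on_compose2[OF Pc]\<close>)
    show "K-lipschitz_on UNIV (\<lambda>y. g (P (fst (y, a)), snd (y, a)))" if "a \<in> U" for a
    proof (rule lipschitz_onI)
      fix x y
      have "dist (g (P x, a)) (g (P y, a)) \<le> K * dist (P x, a) (P y, a)"
        by (rule lipschitz_onD[OF K]) (use that PD in \<open>auto simp: S_def\<close>)
      also have "\<dots> \<le> K * dist x y"
        using Plip lipschitz_on_nonneg[OF K] by (intro mult_left_mono) (auto simp: dist_Pair_Pair)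
      finally show "dist (g (P (fst (x, a)), snd (x, a))) (g (P (fst (y, a)), snd (y, a))) \<le> K * dist x y"
        by simp
    qed (rule lipschitz_on_nonneg[OF K])
    show "\<bar>g (P (fst (y, a)), snd (y, a))\<bar> \<le> M" if "a \<in> U" for y a
      using M[of "(P y, a)"] PD that by (auto simp: S_def)
    show "\<bar>g (P (fst (y, a)), snd (y, a)) - k (y, a)\<bar> \<le> e" if "norm y \<le> R" "a \<in> U" for y a
      using g(2)[of "(y, a)"] that PD[of y] by (auto simp: S_def Pid)
  qed
qed

lemma bounded_closed_neighbourhood:
  fixes Y :: "'a::real_normed_vector set"
  assumes "bounded Y"
  shows "bounded {p. \<exists>y\<in>Y. norm (p - y) \<le> r}"
proof -
  obtain R where R: "\<And>y. y \<in> Y \<Longrightarrow> norm y \<le> R" using assms by (auto simp: bounded_iff)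
  have "norm p \<le> R + r" if "y \<in> Y" "norm (p - y) \<le> r" for p y
    using R[OF that(1)] that(2) norm_triangle_sub[of p y] by linarith
  then show ?thesis unfolding bounded_iff by blast
qed

section \<open>Dynamic programming\<close>

context control_system
begin

definition weighted_cost ::
  "(real \<Rightarrow> real) \<Rightarrow> ((real^'m) \<times> 'u \<Rightarrow> real) \<Rightarrow> real \<Rightarrow> real^'m \<Rightarrow> (real \<Rightarrow> 'u) \<Rightarrow> real" where
  "weighted_cost q g T p u = integral {0..T} (\<lambda>t. q t * g (sol f p u t, u t))"

lemma weighted_cost_integrable:
  fixes g :: "(real^'m) \<times> 'u \<Rightarrow> real"
  assumes g: "continuous_on (UNIV \<times> U) g" and u: "u \<in> controls U" and q: "continuous_on {0..T} q"
  shows "(\<lambda>t. q t * g (sol f p u t, u t)) integrable_on {0..T}"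
  using set_lebesgue_integral_eq_integral(1)[OF cost_absolutely_integrable[OF g u sol_continuous[OF u] compact_U q]]
  by simp

lemma v_T_eq_INF_cost:
  assumes g: "continuous_on (UNIV \<times> U) g"
  shows "v_T f g U T p = (1 / T) * (INF u\<in>controls U. weighted_cost (\<lambda>_. 1) g T p u)"
proof -
  have "(LINT t:{0..T}|lebesgue. g (sol f p u t, u t)) = weighted_cost (\<lambda>_. 1) g T p u"
    if u: "u \<in> controls U" for u
    using set_lebesgue_integral_eq_integral(2)[OF cost_absolutely_integrable[OF g u
          sol_continuous[OF u] compact_U continuous_on_const[of _ 1]]]
    unfolding weighted_cost_def by simp
  then show ?thesis unfolding v_T_def by simp
qed

lemma cost_bound:
  assumes g: "continuous_on (UNIV \<times> U) g" and u: "u \<in> controls U" and q: "continuous_on {0..T} q"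
    and T: "T \<ge> 0" and B: "\<And>t. t \<in> {0..T} \<Longrightarrow> \<bar>q t * g (sol f p u t, u t)\<bar> \<le> B"
  shows "\<bar>weighted_cost q g T p u\<bar> \<le> B * T"
proof -
  have "norm (weighted_cost q g T p u) \<le> integral {0..T} (\<lambda>t. B)"
    unfolding weighted_cost_def
    by (rule Henstock_Kurzweil_Integration.integral_norm_bound_integral[OF weighted_cost_integrable[OF g u q]
          integrable_const_ivl]) (use B in auto)
  then show ?thesis using T by (simp add: mult.commute)
qed

lemma cost_bdd_below:
  assumes g: "continuous_on (UNIV \<times> U) g" and T: "T \<ge> 0"
  shows "bdd_below ((\<lambda>u. weighted_cost (\<lambda>_. 1) g T p u) ` controls U)"
proof -
  obtain R where R: "\<And>p' u t. p' \<in> {p} \<Longrightarrow> u \<in> controls U \<Longrightarrow> t \<in> {0..T} \<Longrightarrow> norm (sol f p' u t) \<le> R"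
    by (rule sol_bounded[of "{p}" T]) auto
  obtain B where B: "B \<ge> 0" "\<And>y a. y \<in> cball 0 R \<Longrightarrow> a \<in> U \<Longrightarrow> norm (g (y, a)) \<le> B"
    by (rule bounded_on_compact[OF g compact_cball[of 0 R]]) blast
  have "- (B * T) \<le> weighted_cost (\<lambda>_. 1) g T p u" if u: "u \<in> controls U" for u
  proof -
    have "\<bar>weighted_cost (\<lambda>_. 1) g T p u\<bar> \<le> B * T"
    proof (rule cost_bound[OF g u continuous_on_const T])
      fix t assume t: "t \<in> {0..T}"
      show "\<bar>1 * g (sol f p u t, u t)\<bar> \<le> B"
        using B(2)[of "sol f p u t" "u t"] R[of p u t] controlsD[OF u, of t] u t by simp
    qed
    then show ?thesis by linarith
  qed
  then show ?thesis by (rule bdd_belowI2)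
qed

text \<open>
  After the initial piece the clock of the second control starts at 0, so the weight is seen
  shifted by \<open>s\<close>.
\<close>

lemma weighted_cost_concat:
  assumes g: "continuous_on (UNIV \<times> U) g" and a: "a \<in> U" and w: "w \<in> controls U"
    and s: "0 \<le> s" "s \<le> T" and q: "continuous_on {0..T} q"
  shows "weighted_cost q g T p (concat_control s a w) =
    integral {0..s} (\<lambda>t. q t * g (sol f p (\<lambda>_. a) t, a)) +
    weighted_cost (\<lambda>t. q (t + s)) g (T - s) (sol f p (\<lambda>_. a) s) w"
  unfolding weighted_cost_def
proof (rule integral_concat[OF s weighted_cost_integrable[OF g concat_control_in[OF a w s(1)] q]])
  fix t assume "t \<in> {0..s}"
  then show "q t * g (sol f p (concat_control s a w) t, concat_control s a w t)
      = q t * g (sol f p (\<lambda>_. a) t, a)"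
    using sol_concat[OF a w s(1), of t p] by (simp add: concat_control_def)
next
  fix t assume "s < t" "t \<le> T"
  then show "q t * g (sol f p (concat_control s a w) t, concat_control s a w t)
      = q (t - s + s) * g (sol f (sol f p (\<lambda>_. a) s) w (t - s), w (t - s))"
    using sol_concat[OF a w s(1), of t p] s by (simp add: concat_control_def)
qed

text \<open>
  Dynamic programming gives \<open>T v\<^sub>T(p) \<le> D + (T - s) v\<^bsub>T-s\<^esub>(q)\<close>, where \<open>q\<close> is the point reached at
  time \<open>s\<close> and \<open>D\<close> is the cost until then. Since \<open>D\<close> is independent of \<open>T\<close>, it disappears on dividing
  by \<open>T\<close>.
\<close>

lemma value_limit_nondecreasing:
  assumes k: "continuous_on (UNIV \<times> U) k" and a: "a \<in> U" and s: "s \<ge> 0"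
    and p: "((\<lambda>T. v_T f k U T p) \<longlongrightarrow> vp) at_top"
    and q: "((\<lambda>T. v_T f k U T (sol f p (\<lambda>_. a) s)) \<longlongrightarrow> vq) at_top"
  shows "vp \<le> vq"
proof -
  let ?q = "sol f p (\<lambda>_. a) s"
  define D where "D = integral {0..s} (\<lambda>t. 1 * k (sol f p (\<lambda>_. a) t, a))"
  have step: "v_T f k U T p \<le> D / T + (1 - s / T) * v_T f k U (T - s) ?q" if T: "T > s" for T
  proof -
    let ?I = "\<lambda>T p. INF u\<in>controls U. weighted_cost (\<lambda>_. 1) k T p u"
    have "?I T p - D \<le> ?I (T - s) ?q"
    proof (rule cINF_greatest[OF controls_nonempty])
      fix w assume w: "w \<in> controls U"
      have "?I T p \<le> weighted_cost (\<lambda>_. 1) k T p (concat_control s a w)"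
        by (rule cINF_lower[OF cost_bdd_below[OF k] concat_control_in[OF a w s]]) (use s T in simp)
      also have "\<dots> = D + weighted_cost (\<lambda>_. 1) k (T - s) ?q w"
        unfolding D_def by (rule weighted_cost_concat[OF k a w s]) (use T in auto)
      finally show "?I T p - D \<le> weighted_cost (\<lambda>_. 1) k (T - s) ?q w" by simp
    qed
    moreover have "?I (T - s) ?q = (T - s) * v_T f k U (T - s) ?q" "?I T p = T * v_T f k U T p"
      using T s by (simp_all add: v_T_eq_INF_cost[OF k])
    ultimately have "T * v_T f k U T p \<le> D + (T - s) * v_T f k U (T - s) ?q" by simp
    then have "(T * v_T f k U T p) / T \<le> (D + (T - s) * v_T f k U (T - s) ?q) / T"
      using T s by (intro divide_right_mono) auto
    also have "\<dots> = D / T + (1 - s / T) * v_T f k U (T - s) ?q"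
      using T s by (simp add: add_divide_distrib diff_divide_distrib left_diff_distrib)
    finally show ?thesis using T s by simp
  qed
  have shift: "filterlim (\<lambda>T. - s + T) at_top at_top"
    by (rule filterlim_tendsto_add_at_top[OF tendsto_const filterlim_ident])
  have inf: "filterlim (\<lambda>T::real. T) at_infinity at_top"
    by (rule filterlim_at_top_imp_at_infinity[OF filterlim_ident])
  have "((\<lambda>T. v_T f k U (- s + T) ?q) \<longlongrightarrow> vq) at_top"
    by (rule filterlim_compose[OF q shift])
  then have "((\<lambda>T. v_T f k U (T - s) ?q) \<longlongrightarrow> vq) at_top" by simp
  then have "((\<lambda>T. D / T + (1 - s / T) * v_T f k U (T - s) ?q) \<longlongrightarrow> 0 + (1 - 0) * vq) at_top"
    by (intro tendsto_add tendsto_mult tendsto_diff tendsto_const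
        tendsto_divide_0[OF tendsto_const inf])
  moreover have "\<forall>\<^sub>F T in at_top. v_T f k U T p \<le> D / T + (1 - s / T) * v_T f k U (T - s) ?q"
    using eventually_gt_at_top[of s] by eventually_elim (rule step)
  ultimately show ?thesis
    using tendsto_le[OF trivial_limit_at_top_linorder _ p] by fastforce
qed

section \<open>Approximate subsolutions\<close>

text \<open>
  Over a time \<open>s\<close> the trajectory from \<open>p\<close> deviates from the straight line with velocity \<open>f (y, a)\<close>
  by at most \<open>s\<close> times a quantity that is small with \<open>norm (p - y)\<close> and \<open>s\<close>. For a Lipschitz
  function the increment along the trajectory can therefore be replaced by the one
  along the line, and \<open>mollification\<close> applies.
\<close>

lemma test_function:
  assumes Y: "bounded Y" and G: "K-lipschitz_on UNIV G" and e: "e > 0" and \<delta>: "\<delta> > 0"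
    and inc: "\<And>y a p s. y \<in> Y \<Longrightarrow> a \<in> U \<Longrightarrow> norm (p - y) \<le> \<delta> \<Longrightarrow> 0 < s \<Longrightarrow> s \<le> \<delta> \<Longrightarrow>
      G (sol f p (\<lambda>_. a) s) - G p \<ge> s * c y a"
  obtains \<phi> where "C1 \<phi>" "\<And>y. y \<in> Y \<Longrightarrow> \<bar>\<phi> y - G y\<bar> \<le> e"
    "\<And>y a. y \<in> Y \<Longrightarrow> a \<in> U \<Longrightarrow> grad \<phi> y \<bullet> f (y, a) \<ge> c y a - e"
proof -
  have K: "K \<ge> 0" using lipschitz_on_nonneg[OF G] .
  define Y1 where "Y1 = {p. \<exists>y\<in>Y. norm (p - y) \<le> 1}"
  have Y1: "bounded Y1" unfolding Y1_def by (rule bounded_closed_neighbourhood[OF Y])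
  obtain C where C: "C > 0"
    "\<And>p u t. p \<in> Y1 \<Longrightarrow> u \<in> controls U \<Longrightarrow> t \<in> {0..1} \<Longrightarrow> norm (sol f p u t - p) \<le> C * t"
    by (rule sol_displacement[OF Y1]) blast
  \<comment> \<open>collects the coefficients of \<open>\<eta>\<close> in the two error bounds \<open>\<eta>2\<close> below\<close>
  define A where "A = 1 + K + K * L * (C + 1)"
  have A: "A \<ge> 1" using K L_nonneg C by (simp add: A_def)
  define \<eta> where "\<eta> = min (min \<delta> 1) (e / A)"
  have \<eta>: "\<eta> > 0" "\<eta> \<le> \<delta>" "\<eta> \<le> 1" "\<eta> * A \<le> e"
  proof -
    have "\<eta> \<le> e / A" by (simp add: \<eta>_def)
    then show "\<eta> * A \<le> e" using A by (simp add: pos_le_divide_eq)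
  qed (use \<delta> e A in \<open>auto simp: \<eta>_def\<close>)
  have \<eta>2: "K * \<eta> \<le> e" "K * (L * (C * \<eta> + \<eta>)) \<le> e"
  proof -
    have "0 \<le> K * L * (C + 1)" using K L_nonneg C by simp
    then have "K \<le> A" "K * L * (C + 1) \<le> A" using K by (simp_all add: A_def)
    then have "\<eta> * K \<le> \<eta> * A" "\<eta> * (K * L * (C + 1)) \<le> \<eta> * A"
      using \<eta>(1) by (simp_all only: mult_left_mono less_imp_le)
    then show "K * \<eta> \<le> e" "K * (L * (C * \<eta> + \<eta>)) \<le> e"
      using \<eta>(4) by (simp_all add: algebra_simps)
  qed
  obtain \<phi> where \<phi>: "C1 \<phi>" "\<And>y. y \<in> Y \<Longrightarrow> \<bar>\<phi> y - G y\<bar> \<le> K * \<eta>"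
    "\<And>y v c s0. y \<in> Y \<Longrightarrow> s0 > 0 \<Longrightarrow>
       (\<And>p s. norm (p - y) \<le> \<eta> \<Longrightarrow> 0 < s \<Longrightarrow> s \<le> s0 \<Longrightarrow> G (p + s *\<^sub>R v) - G p \<ge> s * c) \<Longrightarrow>
       grad \<phi> y \<bullet> v \<ge> c"
    by (rule mollification[OF Y G \<eta>(1)]) blast
  show ?thesis
  proof (rule that[OF \<phi>(1)])
    show "\<bar>\<phi> y - G y\<bar> \<le> e" if "y \<in> Y" for y using \<phi>(2)[OF that] \<eta>2(1) by linarith
    fix y a assume y: "y \<in> Y" and a: "a \<in> U"
    note ca = const_control[OF a]
    show "grad \<phi> y \<bullet> f (y, a) \<ge> c y a - e"
    proof (rule \<phi>(3)[OF y \<eta>(1)])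
      fix p s assume p: "norm (p - y) \<le> \<eta>" and s: "0 < s" "s \<le> \<eta>"
      let ?x = "sol f p (\<lambda>_. a)"
      have pY1: "p \<in> Y1" unfolding Y1_def
        using y p \<eta>(3) by force
      have i: "(\<lambda>t. f (?x t, a)) integrable_on {0..s}"
        using velocity_integrable_on[OF ca sol_continuous[OF ca]] .
      have "?x s - (p + s *\<^sub>R f (y, a)) = integral {0..s} (\<lambda>t. f (?x t, a) - f (y, a))"
        using sol_eq[OF ca, of s p] s
        by (simp add: Henstock_Kurzweil_Integration.integral_diff[OF i integrable_const_ivl])
      also have "norm \<dots> \<le> integral {0..s} (\<lambda>t. L * (C * \<eta> + \<eta>))"
      proof (rule Henstock_Kurzweil_Integration.integral_norm_bound_integral[OF
              integrable_diff[OF i integrable_const_ivl] integrable_const_ivl])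
        fix t assume t: "t \<in> {0..s}"
        have "norm (?x t - y) \<le> norm (?x t - p) + norm (p - y)"
          using norm_triangle_ineq[of "?x t - p" "p - y"] by simp
        also have "norm (?x t - p) \<le> C * t"
          using C(2)[OF pY1 ca, of t] t s \<eta> by simp
        also have "C * t \<le> C * \<eta>" using t s C(1) by (intro mult_left_mono) auto
        finally have "norm (?x t - y) \<le> C * \<eta> + \<eta>" using p by simp
        then have "L * norm (?x t - y) \<le> L * (C * \<eta> + \<eta>)" using L_nonneg by (rule mult_left_mono)
        then show "norm (f (?x t, a) - f (y, a)) \<le> L * (C * \<eta> + \<eta>)"
          using lip_fD[OF a, of "?x t" y] by linarith
      qed
      also have "\<dots> = s * (L * (C * \<eta> + \<eta>))" using s by simp
      finally have dev: "norm (?x s - (p + s *\<^sub>R f (y, a))) \<le> s * (L * (C * \<eta> + \<eta>))" .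
      have "\<bar>G (?x s) - G (p + s *\<^sub>R f (y, a))\<bar> \<le> K * norm (?x s - (p + s *\<^sub>R f (y, a)))"
        using lipschitz_on_normD[OF G] by simp
      also have "\<dots> \<le> K * (s * (L * (C * \<eta> + \<eta>)))"
        using dev K by (rule mult_left_mono)
      also have "\<dots> = s * (K * (L * (C * \<eta> + \<eta>)))" by simp
      also have "\<dots> \<le> s * e" using \<eta>2(2) s by (intro mult_left_mono) auto
      finally have "G (p + s *\<^sub>R f (y, a)) \<ge> G (?x s) - s * e" by linarith
      moreover have "G (?x s) - G p \<ge> s * c y a"
        using inc[OF y a, of p s] p s \<eta> by linarith
      ultimately show "G (p + s *\<^sub>R f (y, a)) - G p \<ge> s * (c y a - e)"
        by (simp add: right_diff_distrib)
    qed
  qed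
qed

text \<open>
  \<open>G\<close> is the infimum over controls of the cost with weight \<open>T - t\<close>, for a Lipschitz cost \<open>k'\<close> that is
  \<open>e\<close>-close to \<open>k\<close> wherever trajectories can go up to time \<open>T\<close>.
  For any control \<open>w\<close>, compare using \<open>w\<close> from the point \<open>q\<close> reached at time \<open>s\<close> with using \<open>w\<close> from
  \<open>q\<close> at once: delaying \<open>w\<close> by \<open>s\<close> changes the weight from \<open>T - t\<close> to \<open>T - t - s\<close>, which saves \<open>s\<close>
  times the plain cost of \<open>w\<close> over \<open>[0, T]\<close>, hence at least \<open>s T (v q - 2 e)\<close>: one \<open>e\<close> for the
  distance of \<open>v\<^sub>T\<close> from \<open>v\<close>, one for that of \<open>k'\<close> from \<open>k\<close>. The initial piece costs about \<open>s T k(y, a)\<close>,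
  with a third \<open>e\<close> for replacing \<open>k\<close> by \<open>k'\<close>; the fourth one absorbs all terms of the order of \<open>\<delta>\<close>.
\<close>

lemma accumulated_value:
  assumes k: "continuous_on (UNIV \<times> U) k" and Y: "compact Y" and N: "open N" "Y \<subseteq> N"
    and v: "Kv-lipschitz_on N v" and e: "e > 0" and T: "T \<ge> 1"
    and near: "\<And>q. q \<in> N \<Longrightarrow> v q - e \<le> v_T f k U T q"
  obtains G K \<delta> where "K-lipschitz_on UNIV G" "\<delta> > 0"
    "\<And>y a p s. y \<in> Y \<Longrightarrow> a \<in> U \<Longrightarrow> norm (p - y) \<le> \<delta> \<Longrightarrow> 0 < s \<Longrightarrow> s \<le> \<delta> \<Longrightarrow>
      G (sol f p (\<lambda>_. a) s) - G p \<ge> s * (T * (v y - k (y, a) - 4 * e))"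
proof -
  define Y1 where "Y1 = {p. \<exists>y\<in>Y. norm (p - y) \<le> 1}"
  have Y1: "bounded Y1" unfolding Y1_def by (rule bounded_closed_neighbourhood[OF compact_imp_bounded[OF Y]])
  have Y1I: "p \<in> Y1" if "y \<in> Y" "norm (p - y) \<le> 1" for p y
    unfolding Y1_def using that by blast
  obtain d where d: "d > 0" "(\<Union>y\<in>Y. ball y d) \<subseteq> N"
    using compact_subset_open_imp_ball_epsilon_subset[OF Y N] by blast
  have dN: "z \<in> N" if "y \<in> Y" "norm (z - y) < d" for y z
  proof -
    have "z \<in> ball y d" using that(2) by (simp add: dist_norm norm_minus_commute)
    then show ?thesis using that(1) d(2) by blast
  qed
  obtain C where C: "C > 0"
    "\<And>p u t. p \<in> Y1 \<Longrightarrow> u \<in> controls U \<Longrightarrow> t \<in> {0..1} \<Longrightarrow> norm (sol f p u t - p) \<le> C * t"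
    by (rule sol_displacement[OF Y1]) blast
  obtain R where R: "\<And>p u t. p \<in> Y1 \<Longrightarrow> u \<in> controls U \<Longrightarrow> t \<in> {0..T} \<Longrightarrow> norm (sol f p u t) \<le> R"
    by (rule sol_bounded[OF Y1]) blast
  obtain k' Kk M where k': "continuous_on (UNIV \<times> U) k'"
    "\<And>a. a \<in> U \<Longrightarrow> Kk-lipschitz_on UNIV (\<lambda>y. k' (y, a))"
    "\<And>y a. a \<in> U \<Longrightarrow> \<bar>k' (y, a)\<bar> \<le> M"
    "\<And>y a. norm y \<le> R \<Longrightarrow> a \<in> U \<Longrightarrow> \<bar>k' (y, a) - k (y, a)\<bar> \<le> e"
    using lipschitz_approximation[OF compact_U k e, of R thesis] by blast
  obtain a0 where a0: "a0 \<in> U" using U_nonempty by blast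
  have Kk: "Kk \<ge> 0" using lipschitz_on_nonneg[OF k'(2)[OF a0]] .
  have M: "M \<ge> 0" using k'(3)[OF a0] by (meson abs_ge_zero order_trans)
  have Kv: "Kv \<ge> 0" using lipschitz_on_nonneg[OF v] .
  let ?J = "\<lambda>w p. weighted_cost (\<lambda>t. T - t) k' T p w"
  have qc: "continuous_on A (\<lambda>t. T - t)" "continuous_on A (\<lambda>t. T - (t + s))" for A s
    by (intro continuous_intros)+
  define G where "G p = (INF w\<in>controls U. ?J w p)" for p
  have bdd: "bdd_below ((\<lambda>w. ?J w p) ` controls U)" for p
  proof -
    have "\<bar>?J w p\<bar> \<le> (T * M) * T" if w: "w \<in> controls U" for w
    proof (rule cost_bound[OF k'(1) w qc(1)])
      fix t assume t: "t \<in> {0..T}"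
      show "\<bar>(T - t) * k' (sol f p w t, w t)\<bar> \<le> T * M"
        unfolding abs_mult using t T k'(3)[of "w t"] controlsD[OF w] by (intro mult_mono) auto
    qed (use T in simp)
    then have "- (T * M * T) \<le> ?J w p" if "w \<in> controls U" for w
      using that by (simp add: abs_le_iff minus_le_iff)
    then show ?thesis by (rule bdd_belowI2)
  qed
  define KG where "KG = T * (Kk * (2 * exp ((2 * L + 1) * T))) * T"
  have KG: "KG \<ge> 0" using T Kk by (simp add: KG_def)
  have G: "KG-lipschitz_on UNIV G"
    unfolding G_def
  proof (rule lipschitz_on_cINF[OF controls_nonempty _ bdd])
    fix w assume w: "w \<in> controls U"
    show "KG-lipschitz_on UNIV (?J w)"
    proof (rule lipschitz_onI[OF _ KG])
      fix p q
      note i = weighted_cost_integrable[OF k'(1) w qc(1)]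
      have "norm (?J w p - ?J w q) =
         norm (integral {0..T} (\<lambda>t. (T - t) * k' (sol f p w t, w t) - (T - t) * k' (sol f q w t, w t)))"
        unfolding weighted_cost_def by (subst Henstock_Kurzweil_Integration.integral_diff[OF i i]) simp
      also have "\<dots> \<le> integral {0..T} (\<lambda>t. T * (Kk * (2 * norm (p - q) * exp ((2 * L + 1) * T))))"
      proof (rule Henstock_Kurzweil_Integration.integral_norm_bound_integral[OF
            integrable_diff[OF i i] integrable_const_ivl])
        fix t assume t: "t \<in> {0..T}"
        then have wt: "w t \<in> U" using controlsD[OF w] by simp
        have "\<bar>k' (sol f p w t, w t) - k' (sol f q w t, w t)\<bar> \<le> Kk * norm (sol f p w t - sol f q w t)"
          using lipschitz_on_normD[OF k'(2)[OF wt]] by simp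
        also have "\<dots> \<le> Kk * (2 * norm (p - q) * exp ((2 * L + 1) * t))"
          using sol_dist[OF w, of t p q] t Kk by (intro mult_left_mono) auto
        also have "\<dots> \<le> Kk * (2 * norm (p - q) * exp ((2 * L + 1) * T))"
          using t Kk L_nonneg by (intro mult_left_mono) (auto intro!: mult_left_mono)
        finally have "\<bar>T - t\<bar> * \<bar>k' (sol f p w t, w t) - k' (sol f q w t, w t)\<bar>
            \<le> T * (Kk * (2 * norm (p - q) * exp ((2 * L + 1) * T)))"
          using t T by (intro mult_mono) auto
        then show "norm ((T - t) * k' (sol f p w t, w t) - (T - t) * k' (sol f q w t, w t))
            \<le> T * (Kk * (2 * norm (p - q) * exp ((2 * L + 1) * T)))"
          by (simp add: right_diff_distrib[symmetric] abs_mult)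
      qed
      also have "\<dots> = KG * norm (p - q)" using T by (simp add: KG_def)
      finally show "dist (?J w p) (?J w q) \<le> KG * dist p q" by (simp add: dist_norm)
    qed
  qed
  \<comment> \<open>collects the coefficients of \<open>\<delta>\<close> in the errors of first order\<close>
  define A where "A = T * ((Kk + Kv) * (C + 1)) + 2 * M + 1"
  have A: "A \<ge> 1" using T Kk Kv C M by (simp add: A_def)
  define \<delta> where "\<delta> = min (min 1 (d / (2 * (C + 1)))) (min (1 / (C + 1)) (e / A))"
  have \<delta>: "\<delta> > 0" "\<delta> \<le> 1" "(C + 1) * \<delta> < d" "(C + 1) * \<delta> \<le> 1" "A * \<delta> \<le> e"
  proof -
    have C1: "C + 1 > 0" using C by simp
    show "\<delta> > 0" "\<delta> \<le> 1" using C1 d e A by (auto simp: \<delta>_def)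
    have "\<delta> \<le> d / (2 * (C + 1))" "\<delta> \<le> 1 / (C + 1)" "\<delta> \<le> e / A" by (auto simp: \<delta>_def)
    then have "\<delta> * (2 * (C + 1)) \<le> d" "\<delta> * (C + 1) \<le> 1" "\<delta> * A \<le> e"
      using C1 A by (simp_all add: pos_le_divide_eq)
    then show "(C + 1) * \<delta> < d" "(C + 1) * \<delta> \<le> 1" "A * \<delta> \<le> e"
      using d by (simp_all add: algebra_simps)
  qed
  have inc: "G (sol f p (\<lambda>_. a) s) - G p \<ge> s * (T * (v y - k (y, a) - 4 * e))"
    if y: "y \<in> Y" and a: "a \<in> U" and p: "norm (p - y) \<le> \<delta>" and s: "0 < s" "s \<le> \<delta>" for y a p s
  proof -
    note ca = const_control[OF a]
    let ?x = "sol f p (\<lambda>_. a)"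
    define q where "q = ?x s"
    define \<rho> where "\<rho> = (C + 1) * \<delta>"
    have pY1: "p \<in> Y1" by (rule Y1I[OF y]) (use p \<delta> in linarith)
    have xy: "norm (?x t - y) \<le> \<rho>" if t: "t \<in> {0..s}" for t
    proof -
      have "norm (?x t - y) \<le> norm (?x t - p) + norm (p - y)"
        using norm_triangle_ineq[of "?x t - p" "p - y"] by simp
      also have "norm (?x t - p) \<le> C * t" using C(2)[OF pY1 ca, of t] t s \<delta> by simp
      also have "C * t \<le> C * \<delta>" using t s C(1) by (intro mult_left_mono) auto
      finally show ?thesis using p by (simp add: \<rho>_def algebra_simps)
    qed
    have qy: "norm (q - y) \<le> \<rho>" unfolding q_def using s by (intro xy) auto
    have qY1: "q \<in> Y1" by (rule Y1I[OF y]) (use qy \<delta> in \<open>simp add: \<rho>_def\<close>)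
    have qN: "q \<in> N" by (rule dN[OF y]) (use qy \<delta>(3) in \<open>simp add: \<rho>_def\<close>)
    have yN: "y \<in> N" using y N by auto
    have yR: "norm y \<le> R"
    proof -
      have "sol f y (\<lambda>_. a) 0 = y" using sol_eq[OF ca, of 0 y] by simp
      then show ?thesis using R[OF Y1I[OF y, of y] ca, of 0] T by simp
    qed
    \<comment> \<open>bound for \<open>k'\<close> along the initial piece\<close>
    define \<kappa> where "\<kappa> = k (y, a) + e + Kk * \<rho>"
    have first: "integral {0..s} (\<lambda>t. (T - t) * k' (?x t, a)) \<le> s * (T * \<kappa> + s * M)"
    proof -
      have "integral {0..s} (\<lambda>t. (T - t) * k' (?x t, a)) \<le> integral {0..s} (\<lambda>t. T * \<kappa> + s * M)"
      proof (rule integral_le[OF weighted_cost_integrable[OF k'(1) ca qc(1)] integrable_const_ivl])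
        fix t assume t: "t \<in> {0..s}"
        have "k' (?x t, a) \<le> k' (y, a) + Kk * norm (?x t - y)"
          using lipschitz_on_normD[OF k'(2)[OF a], of "?x t" y] by simp
        also have "Kk * norm (?x t - y) \<le> Kk * \<rho>" using xy[OF t] Kk by (intro mult_left_mono)
        finally have "k' (?x t, a) \<le> \<kappa>" using k'(4)[OF yR a] by (simp add: \<kappa>_def)
        then have "T * k' (?x t, a) \<le> T * \<kappa>" using T by (intro mult_left_mono) auto
        moreover have "\<bar>t * k' (?x t, a)\<bar> \<le> s * M"
          unfolding abs_mult using t k'(3)[OF a] by (intro mult_mono) auto
        ultimately show "(T - t) * k' (?x t, a) \<le> T * \<kappa> + s * M"
          by (simp add: left_diff_distrib)
      qed
      then show ?thesis using s by simp
    qed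
    have sT: "0 \<le> s" "s \<le> T" using s \<delta> T by auto
    have main: "G p \<le> s * (T * \<kappa> + s * M) + ?J w q - s * (T * (v q - 2 * e)) + s * (s * M)"
      if w: "w \<in> controls U" for w
    proof -
      let ?h = "\<lambda>t. k' (sol f q w t, w t)"
      have "G p \<le> ?J (concat_control s a w) p"
        unfolding G_def by (rule cINF_lower[OF bdd concat_control_in[OF a w sT(1)]])
      also have "\<dots> = integral {0..s} (\<lambda>t. (T - t) * k' (?x t, a))
          + weighted_cost (\<lambda>t. T - (t + s)) k' (T - s) q w"
        unfolding q_def by (rule weighted_cost_concat[OF k'(1) a w sT qc(1)])
      finally have 1: "G p \<le> s * (T * \<kappa> + s * M) + weighted_cost (\<lambda>t. T - (t + s)) k' (T - s) q w"
        using first by linarith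
      have 2: "?J w q = s * weighted_cost (\<lambda>_. 1) k' T q w + weighted_cost (\<lambda>t. T - (t + s)) k' T q w"
      proof -
        have i: "(\<lambda>t. s * (1 * ?h t)) integrable_on {0..T}" "(\<lambda>t. (T - (t + s)) * ?h t) integrable_on {0..T}"
          using weighted_cost_integrable[OF k'(1) w continuous_on_const[of _ s]]
            weighted_cost_integrable[OF k'(1) w qc(2)] by simp_all
        have "?J w q = integral {0..T} (\<lambda>t. s * (1 * ?h t) + (T - (t + s)) * ?h t)"
          unfolding weighted_cost_def
          by (rule Henstock_Kurzweil_Integration.integral_cong) (simp add: algebra_simps)
        also have "\<dots> = integral {0..T} (\<lambda>t. s * (1 * ?h t)) + integral {0..T} (\<lambda>t. (T - (t + s)) * ?h t)"
          by (rule Henstock_Kurzweil_Integration.integral_add[OF i])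
        finally show ?thesis unfolding weighted_cost_def by simp
      qed
      \<comment> \<open>on the last stretch, of length \<open>s\<close>, the shifted weight is negative but at most \<open>s\<close> in size\<close>
      have 3: "weighted_cost (\<lambda>t. T - (t + s)) k' T q w
          \<ge> weighted_cost (\<lambda>t. T - (t + s)) k' (T - s) q w - s * (s * M)"
      proof -
        let ?g = "\<lambda>t. (T - (t + s)) * ?h t"
        have i: "?g integrable_on {0..T}" by (rule weighted_cost_integrable[OF k'(1) w qc(2)])
        have "integral {0..T - s} ?g + integral {T - s..T} ?g = integral {0..T} ?g"
          by (rule Henstock_Kurzweil_Integration.integral_combine[OF _ _ i]) (use sT in auto)
        moreover have "norm (integral {T - s..T} ?g) \<le> integral {T - s..T} (\<lambda>t. s * M)"
        proof (rule Henstock_Kurzweil_Integration.integral_norm_bound_integral[OF _ integrable_const_ivl])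
          show "?g integrable_on {T - s..T}"
            by (rule integrable_on_subinterval[OF i]) (use sT in auto)
          fix t assume t: "t \<in> {T - s..T}"
          show "norm (?g t) \<le> s * M"
            unfolding real_norm_def abs_mult using t sT k'(3)[of "w t"] controlsD[OF w, of t]
            by (intro mult_mono) auto
        qed
        moreover have "integral {T - s..T} (\<lambda>t. s * M) = s * (s * M)" using sT by simp
        ultimately show ?thesis unfolding weighted_cost_def real_norm_def by linarith
      qed
      have 4: "weighted_cost (\<lambda>_. 1) k' T q w \<ge> T * (v q - 2 * e)"
      proof -
        have "T * (v q - e) \<le> T * v_T f k U T q" using near[OF qN] T by (intro mult_left_mono) auto
        also have "\<dots> = (INF u\<in>controls U. weighted_cost (\<lambda>_. 1) k T q u)"
          using T by (simp add: v_T_eq_INF_cost[OF k])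
        also have "\<dots> \<le> weighted_cost (\<lambda>_. 1) k T q w"
          by (rule cINF_lower[OF cost_bdd_below[OF k] w]) (use T in simp)
        also have "\<dots> \<le> integral {0..T} (\<lambda>t. 1 * ?h t + e)"
          unfolding weighted_cost_def
        proof (rule integral_le[OF weighted_cost_integrable[OF k w continuous_on_const]
              integrable_add[OF weighted_cost_integrable[OF k'(1) w continuous_on_const] integrable_const_ivl]])
          fix t assume t: "t \<in> {0..T}"
          show "1 * k (sol f q w t, w t) \<le> 1 * ?h t + e"
            using k'(4)[OF R[OF qY1 w t] controlsD[OF w, of t]] t by simp
        qed
        also have "\<dots> = weighted_cost (\<lambda>_. 1) k' T q w + T * e"
          unfolding weighted_cost_def
          using T by (subst Henstock_Kurzweil_Integration.integral_add[OF
              weighted_cost_integrable[OF k'(1) w continuous_on_const] integrable_const_ivl]) simp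
        finally show ?thesis by (simp add: algebra_simps)
      qed
      have "s * (T * (v q - 2 * e)) \<le> s * weighted_cost (\<lambda>_. 1) k' T q w"
        using 4 sT(1) by (rule mult_left_mono)
      then show ?thesis using 1 2 3 by linarith
    qed
    have "G p - (s * (T * \<kappa> + s * M) - s * (T * (v q - 2 * e)) + s * (s * M)) \<le> G q"
      unfolding G_def[of q] by (rule cINF_greatest[OF controls_nonempty]) (use main in fastforce)
    then have 5: "G q - G p \<ge> s * (T * (v q - 2 * e) - T * \<kappa> - 2 * (s * M))"
      by (simp add: algebra_simps)
    have "v y \<le> v q + Kv * \<rho>"
    proof -
      have "\<bar>v y - v q\<bar> \<le> Kv * norm (q - y)"
        using lipschitz_on_normD[OF v yN qN] by (simp add: norm_minus_commute)
      also have "\<dots> \<le> Kv * \<rho>" using qy Kv by (rule mult_left_mono)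
      finally show ?thesis by linarith
    qed
    then have "T * v y \<le> T * (v q + Kv * \<rho>)" using T by (intro mult_left_mono) auto
    moreover have "T * ((Kk + Kv) * \<rho>) + 2 * (s * M) \<le> T * e"
    proof -
      have "s * M \<le> \<delta> * M" using s M by (intro mult_right_mono) auto
      then have "T * ((Kk + Kv) * \<rho>) + 2 * (s * M) \<le> A * \<delta>"
        using \<delta>(1) by (simp add: A_def \<rho>_def algebra_simps)
      also have "\<dots> \<le> 1 * e" using \<delta>(5) by simp
      also have "\<dots> \<le> T * e" using T e by (intro mult_right_mono) auto
      finally show ?thesis .
    qed
    ultimately have "T * (v y - k (y, a) - 4 * e) \<le> T * (v q - 2 * e) - T * \<kappa> - 2 * (s * M)"
      by (simp add: \<kappa>_def algebra_simps)
    then have "s * (T * (v y - k (y, a) - 4 * e)) \<le> s * (T * (v q - 2 * e) - T * \<kappa> - 2 * (s * M))"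
      using s by (intro mult_left_mono) auto
    then show ?thesis using 5 unfolding q_def by linarith
  qed
  show ?thesis by (rule that[OF G \<delta>(1) inc])
qed

end

section \<open>Integration against the measures in \<open>\<Omega>(y\<^sub>0)\<close>\<close>

lemma integrable_borel_compact:
  fixes h :: "'a::topological_space \<Rightarrow> real"
  assumes \<mu>: "\<mu> \<in> finite_borel_measures X" and X: "compact X" and h: "continuous_on X h"
  shows "integrable \<mu> h"
proof -
  interpret finite_measure \<mu> using \<mu> by (simp add: finite_borel_measures_def)
  have sets: "sets \<mu> = sets (restrict_space borel X)" using \<mu> by (simp add: finite_borel_measures_def)
  then have sp: "space \<mu> = X" using sets_eq_imp_space_eq[OF sets] by (simp add: space_restrict_space)
  obtain B where B: "\<And>x. x \<in> X \<Longrightarrow> norm (h x) \<le> B"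
    using compact_imp_bounded[OF compact_continuous_image[OF h X]] unfolding bounded_iff by blast
  have "h \<in> borel_measurable \<mu>"
    unfolding measurable_cong_sets[OF sets refl] by (rule borel_measurable_continuous_on_restrict[OF h])
  then show ?thesis by (rule integrable_const_bound[rotated, of _ B]) (use B sp in auto)
qed

lemma space_finite_borel_measures: "\<mu> \<in> finite_borel_measures X \<Longrightarrow> space \<mu> = X"
  using sets_eq_imp_space_eq[of \<mu> "restrict_space borel X"]
  by (simp add: finite_borel_measures_def space_restrict_space)

lemma borel_probability_imp_finite: "\<mu> \<in> borel_probability_measures X \<Longrightarrow> \<mu> \<in> finite_borel_measures X"
  by (simp add: borel_probability_measures_def finite_borel_measures_def prob_space.finite_measure)

context control_system
begin

lemma continuous_on_state:
  "continuous_on Y g \<Longrightarrow> continuous_on (Y \<times> U) (\<lambda>(y, u). g y)"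
  unfolding split_beta by (rule continuous_on_compose2[of Y g]) (auto intro!: continuous_intros)

lemma continuous_on_grad_f:
  fixes \<phi> :: "real^'m \<Rightarrow> real"
  assumes "C1 \<phi>"
  shows "continuous_on (Y \<times> U) (\<lambda>(y, u). grad \<phi> y \<bullet> f (y, u))"
proof -
  have "continuous_on (Y \<times> U) f" by (rule continuous_on_subset[OF cont_f]) auto
  moreover have "continuous_on (Y \<times> U) (\<lambda>z. grad \<phi> (fst z))"
    by (rule continuous_on_compose2[OF C1_grad(2)[OF assms]]) (auto intro!: continuous_intros)
  ultimately show ?thesis unfolding split_beta by (auto intro!: continuous_intros)
qed

text \<open>
  Points of a small neighbourhood of \<open>Y\<close> stay in \<open>N\<close> for a short time, and there \<open>v\<close> does not decrease
  along trajectories. So \<open>test_function\<close> applies with lower bound 0; it is used with a Lipschitz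
  extension of \<open>v\<close>, because the test function has to be defined everywhere. The error
  \<open>e * (2 + m)\<close> consists of two replacements of \<open>v\<close> by \<open>\<phi>\<close> and of the loss in the gradient bound,
  weighted by the mass \<open>m\<close> of \<open>\<xi>\<close>.
\<close>

lemma value_le_average_value:
  assumes Y: "compact Y" and N: "open N" "Y \<subseteq> N" and v: "Kv-lipschitz_on N v"
    and k: "continuous_on (UNIV \<times> U) k"
    and lim: "\<And>q. q \<in> N \<Longrightarrow> ((\<lambda>T. v_T f k U T q) \<longlongrightarrow> v q) at_top"
    and y0: "y0 \<in> Y" and \<gamma>\<xi>: "(\<gamma>, \<xi>) \<in> Omega f U Y y0"
  shows "v y0 \<le> (LINT (y, u)|\<gamma>. v y)"
proof -
  have \<gamma>: "\<gamma> \<in> borel_probability_measures (Y \<times> U)" and \<xi>: "\<xi> \<in> finite_borel_measures (Y \<times> U)"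
    and id: "\<And>\<phi>. C1 \<phi> \<Longrightarrow>
       (LINT (y, u)|\<gamma>. \<phi> y0 - \<phi> y) + (LINT (y, u)|\<xi>. grad \<phi> y \<bullet> f (y, u)) = 0"
    using \<gamma>\<xi> by (auto simp: Omega_def)
  interpret \<gamma>: prob_space \<gamma> using \<gamma> by (simp add: borel_probability_measures_def)
  note \<gamma>f = borel_probability_imp_finite[OF \<gamma>]
  note sp = space_finite_borel_measures[OF \<gamma>f] space_finite_borel_measures[OF \<xi>]
  have YU: "compact (Y \<times> U)" using Y compact_U by (rule compact_Times)
  have vY: "continuous_on Y v" using lipschitz_on_continuous_on[OF v] N continuous_on_subset by blast
  obtain G where G: "Kv-lipschitz_on UNIV G" "\<And>x. x \<in> N \<Longrightarrow> G x = v x"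
    by (rule mcshane_extension[OF v]) blast
  define Y1 where "Y1 = {p. \<exists>y\<in>Y. norm (p - y) \<le> 1}"
  have Y1: "bounded Y1" unfolding Y1_def by (rule bounded_closed_neighbourhood[OF compact_imp_bounded[OF Y]])
  obtain d where d: "d > 0" "(\<Union>y\<in>Y. ball y d) \<subseteq> N"
    using compact_subset_open_imp_ball_epsilon_subset[OF Y N] by blast
  have dN: "z \<in> N" if "y \<in> Y" "norm (z - y) < d" for y z
  proof -
    have "z \<in> ball y d" using that(2) by (simp add: dist_norm norm_minus_commute)
    then show ?thesis using that(1) d(2) by blast
  qed
  obtain C where C: "C > 0"
    "\<And>p u t. p \<in> Y1 \<Longrightarrow> u \<in> controls U \<Longrightarrow> t \<in> {0..1} \<Longrightarrow> norm (sol f p u t - p) \<le> C * t"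
    by (rule sol_displacement[OF Y1]) blast
  define \<delta> where "\<delta> = min 1 (d / (2 * (C + 1)))"
  have \<delta>: "\<delta> > 0" "\<delta> \<le> 1" "(C + 1) * \<delta> < d"
  proof -
    have C1: "C + 1 > 0" using C by simp
    then show "\<delta> > 0" "\<delta> \<le> 1" using d by (auto simp: \<delta>_def)
    have "\<delta> \<le> d / (2 * (C + 1))" by (simp add: \<delta>_def)
    then have "\<delta> * (2 * (C + 1)) \<le> d" using C1 by (simp add: pos_le_divide_eq)
    then show "(C + 1) * \<delta> < d" using d by (simp add: algebra_simps)
  qed
  have inc: "G (sol f p (\<lambda>_. a) s) - G p \<ge> s * 0"
    if y: "y \<in> Y" and a: "a \<in> U" and p: "norm (p - y) \<le> \<delta>" and s: "0 < s" "s \<le> \<delta>" for y a p s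
  proof -
    let ?q = "sol f p (\<lambda>_. a) s"
    have "norm (p - y) \<le> 1" using p \<delta> by linarith
    then have pY1: "p \<in> Y1" unfolding Y1_def
      using y by blast
    have "norm (?q - p) \<le> C * s" using C(2)[OF pY1 const_control[OF a], of s] s \<delta> by simp
    also have "\<dots> \<le> C * \<delta>" using s C by (intro mult_left_mono) auto
    finally have "norm (?q - y) \<le> (C + 1) * \<delta>"
      using norm_triangle_ineq[of "?q - p" "p - y"] p by (simp add: algebra_simps)
    then have qN: "?q \<in> N" using \<delta>(3) by (intro dN[OF y]) linarith
    have "0 \<le> C * \<delta>" using C \<delta> by simp
    then have pN: "p \<in> N" using p \<delta>(3) by (intro dN[OF y]) (simp add: algebra_simps)
    have "v p \<le> v ?q" by (rule value_limit_nondecreasing[OF k a _ lim[OF pN] lim[OF qN]]) (use s in simp)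
    then show ?thesis using G(2) pN qN by simp
  qed
  define m where "m = measure \<xi> (Y \<times> U)"
  have key: "v y0 - (LINT (y, u)|\<gamma>. v y) \<le> e * (2 + m)" if e: "e > 0" for e
  proof -
    obtain \<phi> where \<phi>: "C1 \<phi>" "\<And>y. y \<in> Y \<Longrightarrow> \<bar>\<phi> y - G y\<bar> \<le> e"
      "\<And>y a. y \<in> Y \<Longrightarrow> a \<in> U \<Longrightarrow> grad \<phi> y \<bullet> f (y, a) \<ge> 0 - e"
      by (rule test_function[OF compact_imp_bounded[OF Y] G(1) e \<delta>(1), of "\<lambda>_ _. 0"])
        (use inc in blast)+
    have close: "\<bar>\<phi> y - v y\<bar> \<le> e" if "y \<in> Y" for y
      using \<phi>(2)[OF that] G(2)[of y] that N by auto
    have \<phi>Y: "continuous_on Y (\<lambda>y. \<phi> y0 - \<phi> y)"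
      by (intro continuous_intros continuous_on_subset[OF C1_grad(1)[OF \<phi>(1)]]) auto
    have iv: "integrable \<gamma> (\<lambda>(y, u). v y)"
      by (rule integrable_borel_compact[OF \<gamma>f YU continuous_on_state[OF vY]])
    have "v y0 - (LINT (y, u)|\<gamma>. v y) - 2 * e = (LINT z|\<gamma>. (v y0 - 2 * e) - (\<lambda>(y, u). v y) z)"
      using iv by (simp add: \<gamma>.prob_space)
    also have "\<dots> \<le> (LINT (y, u)|\<gamma>. \<phi> y0 - \<phi> y)"
    proof (rule integral_mono)
      show "integrable \<gamma> (\<lambda>z. (v y0 - 2 * e) - (\<lambda>(y, u). v y) z)" using iv by simp
      show "integrable \<gamma> (\<lambda>(y, u). \<phi> y0 - \<phi> y)"
        by (rule integrable_borel_compact[OF \<gamma>f YU continuous_on_state[OF \<phi>Y]])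
      show "(v y0 - 2 * e) - (\<lambda>(y, u). v y) z \<le> (\<lambda>(y, u). \<phi> y0 - \<phi> y) z" if "z \<in> space \<gamma>" for z
        using that close[OF y0] close[of "fst z"] unfolding sp by (auto simp: abs_le_iff)
    qed
    also have "\<dots> = - (LINT (y, u)|\<xi>. grad \<phi> y \<bullet> f (y, u))" using id[OF \<phi>(1)] by linarith
    also have "\<dots> \<le> e * m"
    proof -
      interpret \<xi>: finite_measure \<xi> using \<xi> by (simp add: finite_borel_measures_def)
      have "(LINT z|\<xi>. - e) \<le> (LINT (y, u)|\<xi>. grad \<phi> y \<bullet> f (y, u))"
      proof (rule integral_mono)
        show "integrable \<xi> (\<lambda>(y, u). grad \<phi> y \<bullet> f (y, u))"
          by (rule integrable_borel_compact[OF \<xi> YU continuous_on_grad_f[OF \<phi>(1)]])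
        show "- e \<le> (\<lambda>(y, u). grad \<phi> y \<bullet> f (y, u)) z" if "z \<in> space \<xi>" for z
          using that \<phi>(3)[of "fst z" "snd z"] unfolding sp by auto
      qed simp
      then show ?thesis by (simp add: m_def sp mult.commute)
    qed
    finally show ?thesis by (simp add: algebra_simps)
  qed
  have m: "2 + m > 0" by (simp add: m_def add_pos_nonneg)
  show ?thesis
  proof (rule field_le_epsilon)
    fix \<epsilon> :: real assume "\<epsilon> > 0"
    then have "v y0 - (LINT (y, u)|\<gamma>. v y) \<le> \<epsilon> / (2 + m) * (2 + m)" using m by (intro key) simp
    then show "v y0 \<le> (LINT (y, u)|\<gamma>. v y) + \<epsilon>" using m by simp
  qed
qed

text \<open>
  Integrating the gradient bound that \<open>accumulated_value\<close> and \<open>test_function\<close> provide against a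
  stationary measure leaves \<open>T * (\<integral>v d\<gamma> - \<integral>k d\<gamma> - 4 e) \<le> e\<close>; a horizon \<open>T \<ge> 1\<close> makes the
  last error at most \<open>T * e\<close>.
\<close>

lemma average_value_le_average_cost:
  assumes Y: "compact Y" and N: "open N" "Y \<subseteq> N" and v: "Kv-lipschitz_on N v"
    and k: "continuous_on (UNIV \<times> U) k"
    and lim: "uniform_limit N (v_T f k U) v at_top" and \<gamma>: "\<gamma> \<in> W_set f U Y"
  shows "(LINT (y, u)|\<gamma>. v y) \<le> (LINT z|\<gamma>. k z)"
proof -
  have \<gamma>p: "\<gamma> \<in> borel_probability_measures (Y \<times> U)"
    and stat: "\<And>\<phi>. C1 \<phi> \<Longrightarrow> (LINT (y, u)|\<gamma>. grad \<phi> y \<bullet> f (y, u)) = 0"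
    using \<gamma> by (auto simp: W_set_def)
  interpret \<gamma>: prob_space \<gamma> using \<gamma>p by (simp add: borel_probability_measures_def)
  note \<gamma>f = borel_probability_imp_finite[OF \<gamma>p]
  note sp = space_finite_borel_measures[OF \<gamma>f]
  have YU: "compact (Y \<times> U)" using Y compact_U by (rule compact_Times)
  have vY: "continuous_on Y v" using lipschitz_on_continuous_on[OF v] N continuous_on_subset by blast
  have iv: "integrable \<gamma> (\<lambda>(y, u). v y)"
    by (rule integrable_borel_compact[OF \<gamma>f YU continuous_on_state[OF vY]])
  have ik: "integrable \<gamma> k"
    by (rule integrable_borel_compact[OF \<gamma>f YU continuous_on_subset[OF k]]) auto
  have key: "(LINT (y, u)|\<gamma>. v y) - (LINT z|\<gamma>. k z) \<le> 5 * e" if e: "e > 0" for e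
  proof -
    have "\<forall>\<^sub>F T in at_top. (\<forall>q\<in>N. dist (v_T f k U T q) (v q) < e) \<and> T \<ge> 1"
      using uniform_limitD[OF lim e] eventually_ge_at_top by (rule eventually_conj)
    then obtain T where T: "T \<ge> 1" "\<forall>q\<in>N. dist (v_T f k U T q) (v q) < e"
      using eventually_happens'[OF trivial_limit_at_top_linorder] by blast
    have near: "v q - e \<le> v_T f k U T q" if "q \<in> N" for q
    proof -
      have "dist (v_T f k U T q) (v q) < e" using T(2) that by blast
      then show ?thesis unfolding dist_real_def by linarith
    qed
    obtain G K \<delta> where G: "K-lipschitz_on UNIV G" "\<delta> > 0"
      "\<And>y a p s. y \<in> Y \<Longrightarrow> a \<in> U \<Longrightarrow> norm (p - y) \<le> \<delta> \<Longrightarrow> 0 < s \<Longrightarrow> s \<le> \<delta> \<Longrightarrow>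
        G (sol f p (\<lambda>_. a) s) - G p \<ge> s * (T * (v y - k (y, a) - 4 * e))"
      by (rule accumulated_value[OF k Y N v e T(1) near]) blast+
    obtain \<phi> where \<phi>: "C1 \<phi>"
      "\<And>y a. y \<in> Y \<Longrightarrow> a \<in> U \<Longrightarrow> grad \<phi> y \<bullet> f (y, a) \<ge> T * (v y - k (y, a) - 4 * e) - e"
      by (rule test_function[OF compact_imp_bounded[OF Y] G(1) e G(2),
            of "\<lambda>y a. T * (v y - k (y, a) - 4 * e)"]) (use G(3) in blast)+
    have "T * ((LINT (y, u)|\<gamma>. v y) - (LINT z|\<gamma>. k z) - 4 * e) - e
        = (LINT z|\<gamma>. T * ((\<lambda>(y, u). v y) z - k z - 4 * e) - e)"
      using iv ik by (simp add: \<gamma>.prob_space)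
    also have "\<dots> \<le> (LINT (y, u)|\<gamma>. grad \<phi> y \<bullet> f (y, u))"
    proof (rule integral_mono)
      show "integrable \<gamma> (\<lambda>z. T * ((\<lambda>(y, u). v y) z - k z - 4 * e) - e)" using iv ik by simp
      show "integrable \<gamma> (\<lambda>(y, u). grad \<phi> y \<bullet> f (y, u))"
        by (rule integrable_borel_compact[OF \<gamma>f YU continuous_on_grad_f[OF \<phi>(1)]])
      show "T * ((\<lambda>(y, u). v y) z - k z - 4 * e) - e \<le> (\<lambda>(y, u). grad \<phi> y \<bullet> f (y, u)) z"
        if "z \<in> space \<gamma>" for z
        using that \<phi>(2)[of "fst z" "snd z"] unfolding sp by auto
    qed
    also have "\<dots> = 0" by (rule stat[OF \<phi>(1)])
    finally have "T * ((LINT (y, u)|\<gamma>. v y) - (LINT z|\<gamma>. k z) - 4 * e) \<le> 1 * e" by simp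
    also have "\<dots> \<le> T * e" using T e by (intro mult_right_mono) auto
    finally have "(LINT (y, u)|\<gamma>. v y) - (LINT z|\<gamma>. k z) - 4 * e \<le> e"
      by (rule mult_left_le_imp_le) (use T in simp)
    then show ?thesis by simp
  qed
  show ?thesis
  proof (rule field_le_epsilon)
    fix \<epsilon> :: real assume "\<epsilon> > 0"
    then show "(LINT (y, u)|\<gamma>. v y) \<le> (LINT z|\<gamma>. k z) + \<epsilon>" using key[of "\<epsilon> / 5"] by simp
  qed
qed

end

theorem proposition3p1:
  fixes U :: "'u::metric_space set"
    and f :: "(real^'m) \<times> 'u \<Rightarrow> real^'m"
    and k :: "(real^'m) \<times> 'u \<Rightarrow> real"
    and Y N :: "(real^'m) set"
    and v_star :: "real^'m \<Rightarrow> real"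
  assumes "compact U"
    and "continuous_on (UNIV \<times> U) f"
    and "\<exists>L. \<forall>u\<in>U. L-lipschitz_on UNIV (\<lambda>y. f (y, u))"
    and "continuous_on (UNIV \<times> U) k"
    and "compact Y"
    and "closure (interior Y) = Y"
    and forward_invariant: "\<forall>y0\<in>Y. admissible_controls f U Y y0 = controls U"
    and "open N" and "Y \<subseteq> N"
    and uniform_limit: "uniform_limit N (v_T f k U) v_star at_top"
    and lipschitz: "\<exists>L. L-lipschitz_on N v_star"
  shows "\<forall>y0\<in>Y. Omega f U Y y0 \<noteq> {} \<longrightarrow> v_star y0 \<le> k_star f k U Y y0"
proof (intro ballI impI)
  fix y0 assume y0: "y0 \<in> Y" and \<Omega>: "Omega f U Y y0 \<noteq> {}"
  obtain L where L: "\<And>u. u \<in> U \<Longrightarrow> L-lipschitz_on UNIV (\<lambda>y. f (y, u))" using assms(3) by blast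
  obtain Kv where v: "Kv-lipschitz_on N v_star" using lipschitz by blast
  have "v_star y0 \<le> (LINT z|\<gamma>. k z)" if \<gamma>\<xi>: "(\<gamma>, \<xi>) \<in> Omega f U Y y0" for \<gamma> \<xi>
  proof -
    have \<gamma>: "\<gamma> \<in> borel_probability_measures (Y \<times> U)" "\<gamma> \<in> W_set f U Y"
      using \<gamma>\<xi> by (auto simp: Omega_def)
    have "U \<noteq> {}"
    proof
      assume "U = {}"
      then have "space \<gamma> = {}"
        using space_finite_borel_measures[OF borel_probability_imp_finite[OF \<gamma>(1)]] by simp
      moreover have "prob_space \<gamma>" using \<gamma>(1) by (simp add: borel_probability_measures_def)
      ultimately show False using prob_space.not_empty by blast
    qed
    then interpret control_system U f L
      using assms(1,2) L by unfold_locales auto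
    have lim: "((\<lambda>T. v_T f k U T q) \<longlongrightarrow> v_star q) at_top" if "q \<in> N" for q
      using tendsto_uniform_limitI[OF uniform_limit that] .
    have "v_star y0 \<le> (LINT (y, u)|\<gamma>. v_star y)"
      by (rule value_le_average_value[OF assms(5,8,9) v assms(4) lim y0 \<gamma>\<xi>])
    also have "\<dots> \<le> (LINT z|\<gamma>. k z)"
      by (rule average_value_le_average_cost[OF assms(5,8,9) v assms(4) uniform_limit \<gamma>(2)])
    finally show ?thesis .
  qed
  then show "v_star y0 \<le> k_star f k U Y y0"
    unfolding k_star_def by (intro cINF_greatest[OF \<Omega>]) auto
qed

end
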